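(* Let $\lambda\in\mathbf{k}$ with $\lambda\neq0$. Let $A=\mathbf{k}[X]/I_A$ be a commutative algebra with a well-ordered generating set $X$ and a defining ideal $I_A$. If $I_A$ is generated by a Gröbner-Shirshov basis $S_A$ in $\mathbf{k}[X]$ (with respect to the deg-lex order on $[X]$), then $\hat S_A:=\hat i_X(S_A)$ is a (differential) Gröbner-Shirshov basis in $\mathbf{k}[\Delta(X)]$, and the free commutative differential algebra $\mathcal{CD}_\lambda(A)$ of weight $\lambda$ on $A$ is isomorphic to $\mathbf{k}[\Delta(X)]/\mathrm{DI}(\hat S_A)$ as commutative differential algebras.
   Context: $\mathbf{k}$ is a field of characteristic $0$; algebras are associative unital $\mathbf{k}$-algebras. **Differential algebras.** A differential algebra of weight $\lambda$ is an algebra $R$ with a linear map $d:R\to R$ such that $d(xy)=d(x)y+x\,d(y)+\lambda d(x)d(y)$ for all $x,y\in R$ and $d(1)=0$; homomorphisms are algebra homomorphisms commuting with the operators. A differential ideal is an ideal $I$ with $d(I)\subseteq I$; $\mathrm{DI}(U)$ is the smallest differential ideal containing $U$. The free commutative differential algebra of weight $\lambda$ on a commutative algebra $A$ is a commutative differential algebra $(\mathcal{CD}_\lambda(A),d_A)$ of weight $\lambda$ with an algebra homomorphism $i_A:A\to\mathcal{CD}_\lambda(A)$ such that every algebra homomorphism $\varphi:A\to R$ to a commutative differential algebra $(R,d)$ of weight $\lambda$ factors as $\varphi=\bar\varphi\circ i_A$ for a unique differential algebra homomorphism $\bar\varphi$. **The algebra $\mathbf{k}[\Delta(X)]$.** $\Delta(X)=\{x^{(n)}\mid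 x\in X,\ n\ge0\}$ (distinct symbols). $\mathbf{k}[\Delta(X)]$ is the commutative polynomial algebra, with the unique weight-$\lambda$ differential operator $d_X$ such that $d_X(x^{(n)})=x^{(n+1)}$. $[Y]$ is the free commutative monoid on $Y$ (monomials, including $1$). $\hat i_X:\mathbf{k}[X]\to\mathbf{k}[\Delta(X)]$ is the algebra embedding $x\mapsto x^{(0)}$. **Orders.** The well-order $<$ on $X$ is extended to $\Delta(X)$ by: $x^{(m)}\prec y^{(n)}$ iff $m<n$, or $m=n$ and $x<y$. On $[\Delta(X)]$ the order $\prec$ is: for $\mathfrak u=u_1\cdots u_p$, $\mathfrak v=v_1\cdots v_q$ with $u_1\succeq\cdots\succeq u_p$, $v_1\succeq\cdots\succeq v_q$ in $\Delta(X)$, $\mathfrak u\prec\mathfrak v$ iff $p<q$, or $p=q$ and for some $k\le p$, $u_1=v_1,\dots,u_{k-1}=v_{k-1}$, $u_k\prec v_k$. The deg-lex order on $[X]$ is defined in the same way from $<$ on $X$. $|u|$ is the number of letters of $u$ counted with multiplicity. $\overline f$ denotes the leading monomial of $f\neq0$, $\mathrm{lc}(f)$ its leading coefficient, $f^\natural=\mathrm{lc}(f)^{-1}f$; $\overline h$ and $h^\natural$ are only formed for $h\ne0$. **Gröbner(-Shirshov) bases in $\mathbf{k}[X]$.** A set $S$ of monic polynomials such that for all $f,g\in S$ and $w=\overline f u=\overline g v$ with $u,v\in[X]$, $|w|<|\overline f|+|\overline g|$, the element $fu-gv$ equals a finite sum $\sum_r c_r s_r u_r$ with $c_r\in\mathbf{k}$,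 $s_r\in S$, $u_r\in[X]$, $\overline{s_r}u_r<w$. **Differential Gröbner-Shirshov bases in $\mathbf{k}[\Delta(X)]$.** A set $S$ of monic polynomials in $\mathbf{k}[\Delta(X)]$ is a (differential) Gröbner-Shirshov basis if for all $f,g\in S$, $i,j\ge0$, and $w=\overline{d_X^i(f)}u=\overline{d_X^j(g)}v$ with $u,v\in[\Delta(X)]$ and $|w|<|\overline f|+|\overline g|$, the composition $d_X^i(f)^\natural u-d_X^j(g)^\natural v$ equals a finite sum $\sum_r c_r d_X^{k_r}(s_r)u_r$ with $c_r\in\mathbf{k}$, $s_r\in S$, $k_r\ge0$, $u_r\in[\Delta(X)]$ and $\overline{d_X^{k_r}(s_r)}u_r\prec w$ for all $r$. *)

theory Defs
  imports
    "HOL-Algebra.Algebraic_Closure_Type"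
    "HOL-Algebra.Module"
    "HOL-Library.Poly_Mapping"
    "HOL-Library.Product_Lexorder"
begin

section \<open>Commutative algebras and differential algebras of weight \<open>lam\<close>\<close>

text \<open>
  The base field is a type \<open>'k\<close>, seen as a ring record through \<^const>\<open>ring_of_type_algebra\<close>.
  Commutative associative unital algebras over it are given by the library locale
  \<^locale>\<open>algebra\<close>. They have explicit carriers because quotients by ideals are needed.
\<close>

locale comm_diff_algebra =
  algebra "ring_of_type_algebra :: 'k::field ring" R
  for R :: "('k::field, 'r) module" (structure) +
  fixes lam :: 'k and d :: "'r \<Rightarrow> 'r"
  assumes d_closed: "x \<in> carrier R \<Longrightarrow> d x \<in> carrier R"
    and d_add: "x \<in> carrier R \<Longrightarrow> y \<in> carrier R \<Longrightarrow> d (x \<oplus>\<^bsub>R\<^esub> y) = d x \<oplus>\<^bsub>R\<^esub> d y"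
    and d_smult: "x \<in> carrier R \<Longrightarrow> d (c \<odot>\<^bsub>R\<^esub> x) = c \<odot>\<^bsub>R\<^esub> d x"
    and d_mult: "x \<in> carrier R \<Longrightarrow> y \<in> carrier R \<Longrightarrow>
      d (x \<otimes>\<^bsub>R\<^esub> y) =
        d x \<otimes>\<^bsub>R\<^esub> y \<oplus>\<^bsub>R\<^esub> x \<otimes>\<^bsub>R\<^esub> d y \<oplus>\<^bsub>R\<^esub> lam \<odot>\<^bsub>R\<^esub> (d x \<otimes>\<^bsub>R\<^esub> d y)"
    and d_one: "d \<one>\<^bsub>R\<^esub> = \<zero>\<^bsub>R\<^esub>"

definition alg_hom :: "('k, 'a) module \<Rightarrow> ('k, 'b) module \<Rightarrow> ('a \<Rightarrow> 'b) set" where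
  "alg_hom A B =
     {h \<in> ring_hom A B. \<forall>c. \<forall>x\<in>carrier A. h (c \<odot>\<^bsub>A\<^esub> x) = c \<odot>\<^bsub>B\<^esub> h x}"

definition diff_alg_hom ::
  "('k, 'a) module \<Rightarrow> ('a \<Rightarrow> 'a) \<Rightarrow> ('k, 'b) module \<Rightarrow> ('b \<Rightarrow> 'b) \<Rightarrow> ('a \<Rightarrow> 'b) set" where
  "diff_alg_hom A dA B dB = {h \<in> alg_hom A B. \<forall>x\<in>carrier A. h (dA x) = dB (h x)}"

definition diff_alg_isomorphic ::
  "('k, 'a) module \<Rightarrow> ('a \<Rightarrow> 'a) \<Rightarrow> ('k, 'b) module \<Rightarrow> ('b \<Rightarrow> 'b) \<Rightarrow> bool" where
  "diff_alg_isomorphic A dA B dB \<longleftrightarrow>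
     (\<exists>h \<in> diff_alg_hom A dA B dB. bij_betw h (carrier A) (carrier B))"

definition diff_ideal :: "('k, 'r) module \<Rightarrow> ('r \<Rightarrow> 'r) \<Rightarrow> 'r set \<Rightarrow> bool" where
  "diff_ideal R d J \<longleftrightarrow> ideal J R \<and> d ` J \<subseteq> J"

definition DI :: "('k, 'r) module \<Rightarrow> ('r \<Rightarrow> 'r) \<Rightarrow> 'r set \<Rightarrow> 'r set" where
  "DI R d U = \<Inter>{J. diff_ideal R d J \<and> U \<subseteq> J}"

text \<open>
  The map on cosets induced by \<open>f\<close>: the coset of \<open>x\<close> goes to \<open>J +> f x\<close>, whenever this does
  not depend on the representative (same set-level encoding as \<^const>\<open>rcoset_mult\<close>).
\<close>

definition coset_map :: "('k, 'b) module \<Rightarrow> 'b set \<Rightarrow> ('a \<Rightarrow> 'b) \<Rightarrow> 'a set \<Rightarrow> 'b set" where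
  "coset_map B J f K = (\<Union>x\<in>K. a_r_coset B J (f x))"

definition alg_quot :: "('k, 'r) module \<Rightarrow> 'r set \<Rightarrow> ('k, 'r set) module" where
  "alg_quot R J =
     ring.extend (R Quot J) (module.fields (\<lambda>c. coset_map R J (\<lambda>x. c \<odot>\<^bsub>R\<^esub> x)))"

text \<open>
  The universal property of the free commutative differential algebra \<open>(C, dC)\<close> with
  \<open>i : A \<rightarrow> C\<close>. HOL cannot quantify over types inside a formula, so the type \<open>'r\<close> carrying
  the test algebras is a parameter. Uniqueness of the factorization is that of a map on the
  carrier, hence the condition \<^const>\<open>extensional\<close>.
\<close>

definition free_comm_diff_algebra ::
  "'r itself \<Rightarrow> 'k::field \<Rightarrow> ('k, 'a) module \<Rightarrow>
     ('k, 'c) module \<Rightarrow> ('c \<Rightarrow> 'c) \<Rightarrow> ('a \<Rightarrow> 'c) \<Rightarrow> bool" where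
  "free_comm_diff_algebra T lam A C dC i \<longleftrightarrow>
     comm_diff_algebra C lam dC \<and> i \<in> alg_hom A C \<and>
     (\<forall>(R :: ('k, 'r) module) d \<phi>. comm_diff_algebra R lam d \<and> \<phi> \<in> alg_hom A R \<longrightarrow>
        (\<exists>!\<psi>. \<psi> \<in> extensional (carrier C) \<and> \<psi> \<in> diff_alg_hom C dC R d \<and>
              (\<forall>a\<in>carrier A. \<psi> (i a) = \<phi> a)))"


section \<open>Polynomial algebras\<close>

text \<open>
  The free commutative monoid on \<open>Y\<close> consists of the finite multisets over \<open>Y\<close> (written
  additively), and the polynomial algebra is its monoid algebra. The set \<open>Y\<close> of variables is
  an arbitrary, possibly empty, subset of a type.
\<close>

type_synonym ('y, 'k) mpoly = "'y multiset \<Rightarrow>\<^sub>0 'k"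

definition mons :: "'y set \<Rightarrow> 'y multiset set" where
  "mons Y = {u. set_mset u \<subseteq> Y}"

abbreviation mon :: "'y multiset \<Rightarrow> ('y, 'k::comm_ring_1) mpoly" where
  "mon u \<equiv> Poly_Mapping.single u 1"

abbreviation cst :: "'k::comm_ring_1 \<Rightarrow> ('y, 'k) mpoly" where
  "cst c \<equiv> Poly_Mapping.single {#} c"

definition poly_alg :: "'y set \<Rightarrow> ('k::comm_ring_1, ('y, 'k) mpoly) module" where
  "poly_alg Y = \<lparr>carrier = {p. Poly_Mapping.keys p \<subseteq> mons Y}, monoid.mult = (*), one = 1, zero = 0, add = (+),
                 module.smult = (\<lambda>c p. cst c * p)\<rparr>"


section \<open>Deg-lex order and leading monomials\<close>

text \<open>
  Letters are listed in decreasing order; \<^const>\<open>lenlex\<close> compares first the lengths, then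
  lexicographically from the left.
\<close>

definition deglex :: "'y::linorder multiset \<Rightarrow> 'y multiset \<Rightarrow> bool" (infix \<open>\<prec>\<close> 50) where
  "u \<prec> v \<longleftrightarrow>
     (rev (sorted_list_of_multiset u), rev (sorted_list_of_multiset v)) \<in> lenlex {(a, b). a < b}"

definition lm :: "('y::linorder, 'k::zero) mpoly \<Rightarrow> 'y multiset" where
  "lm f = (THE u. u \<in> Poly_Mapping.keys f \<and> (\<forall>v\<in>Poly_Mapping.keys f. v = u \<or> v \<prec> u))"

definition lc :: "('y::linorder, 'k::zero) mpoly \<Rightarrow> 'k" where
  "lc f = Poly_Mapping.lookup f (lm f)"

definition monic :: "('y::linorder, 'k::comm_ring_1) mpoly \<Rightarrow> bool" where
  "monic f \<longleftrightarrow> f \<noteq> 0 \<and> lc f = 1"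

definition normalized :: "('y::linorder, 'k::field) mpoly \<Rightarrow> ('y, 'k) mpoly" where
  "normalized f = cst (inverse (lc f)) * f"

text \<open>\<open>h\<close> is a finite sum \<open>\<Sum>\<^sub>r c\<^sub>r p\<^sub>r u\<^sub>r\<close> with \<open>p\<^sub>r\<close> in \<open>P\<close> and leading monomials below \<open>w\<close>.\<close>

definition sum_below ::
  "'y::linorder set \<Rightarrow> ('y, 'k::comm_ring_1) mpoly set \<Rightarrow> 'y multiset \<Rightarrow> ('y, 'k) mpoly \<Rightarrow> bool"
  where
  "sum_below Y P w h \<longleftrightarrow>
     (\<exists>(n::nat) c p u.
        (\<forall>r<n. p r \<in> P \<and> p r \<noteq> 0 \<and> u r \<in> mons Y \<and> lm (p r) + u r \<prec> w) \<and>
        h = (\<Sum>r<n. cst (c r) * p r * mon (u r)))"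

definition gs_basis :: "'x::linorder set \<Rightarrow> ('x, 'k::comm_ring_1) mpoly set \<Rightarrow> bool" where
  "gs_basis Xs S \<longleftrightarrow>
     S \<subseteq> carrier (poly_alg Xs) \<and> (\<forall>f\<in>S. monic f) \<and>
     (\<forall>f\<in>S. \<forall>g\<in>S. \<forall>u\<in>mons Xs. \<forall>v\<in>mons Xs. \<forall>w.
        w = lm f + u \<and> w = lm g + v \<and> size w < size (lm f) + size (lm g) \<longrightarrow>
        sum_below Xs S w (f * mon u - g * mon v))"


section \<open>The differential polynomial algebra\<close>

text \<open>
  The letter \<open>x\<^sup>(\<^sup>n\<^sup>)\<close> is the pair \<open>(n, x)\<close>, so the lexicographic order of
  \<^theory>\<open>HOL-Library.Product_Lexorder\<close> is the order on letters: first by \<open>n\<close>, then by \<open>x\<close>.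
\<close>

definition Delta :: "'x set \<Rightarrow> (nat \<times> 'x) set" where
  "Delta Xs = UNIV \<times> Xs"

definition i_hat :: "('x, 'k::comm_ring_1) mpoly \<Rightarrow> (nat \<times> 'x, 'k) mpoly" where
  "i_hat p = (\<Sum>u\<in>Poly_Mapping.keys p. Poly_Mapping.single (image_mset (Pair 0) u) (Poly_Mapping.lookup p u))"

text \<open>
  The operator \<open>d\<^sub>X\<close> is computed on a word by iterating the Leibniz rule of weight \<open>lam\<close> and
  extended linearly. The theorem \<open>der_characterization\<close> below shows that it is the unique
  differential operator of weight \<open>lam\<close> with \<open>x\<^sup>(\<^sup>n\<^sup>) \<mapsto> x\<^sup>(\<^sup>n\<^sup>+\<^sup>1\<^sup>)\<close>.
\<close>

fun der_word :: "'k::comm_ring_1 \<Rightarrow> (nat \<times> 'x) list \<Rightarrow> (nat \<times> 'x, 'k) mpoly" where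
  "der_word lam [] = 0"
| "der_word lam ((n, x) # ys) =
     mon {#(Suc n, x)#} * mon (mset ys) + mon {#(n, x)#} * der_word lam ys +
     cst lam * (mon {#(Suc n, x)#} * der_word lam ys)"

definition der ::
  "'k::comm_ring_1 \<Rightarrow> (nat \<times> 'x::linorder, 'k) mpoly \<Rightarrow> (nat \<times> 'x, 'k) mpoly" where
  "der lam p =
     (\<Sum>u\<in>Poly_Mapping.keys p. cst (Poly_Mapping.lookup p u) * der_word lam (sorted_list_of_multiset u))"

definition diff_gs_basis ::
  "'k::field \<Rightarrow> 'x::linorder set \<Rightarrow> (nat \<times> 'x, 'k) mpoly set \<Rightarrow> bool" where
  "diff_gs_basis lam Xs S \<longleftrightarrow>
     S \<subseteq> carrier (poly_alg (Delta Xs)) \<and> (\<forall>f\<in>S. monic f) \<and>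
     (\<forall>f\<in>S. \<forall>g\<in>S. \<forall>i j. \<forall>u\<in>mons (Delta Xs). \<forall>v\<in>mons (Delta Xs). \<forall>w.
        (der lam ^^ i) f \<noteq> 0 \<and> (der lam ^^ j) g \<noteq> 0 \<and>
        w = lm ((der lam ^^ i) f) + u \<and> w = lm ((der lam ^^ j) g) + v \<and>
        size w < size (lm f) + size (lm g) \<longrightarrow>
        sum_below (Delta Xs) {(der lam ^^ k) s | k s. s \<in> S} w
          (normalized ((der lam ^^ i) f) * mon u - normalized ((der lam ^^ j) g) * mon v))"

lemma poly_alg_simps [simp]:
  "carrier (poly_alg Y) = {p. Poly_Mapping.keys p \<subseteq> mons Y}"
  "x \<otimes>\<^bsub>poly_alg Y\<^esub> y = x * y"
  "\<one>\<^bsub>poly_alg Y\<^esub> = 1"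
  "\<zero>\<^bsub>poly_alg Y\<^esub> = 0"
  "x \<oplus>\<^bsub>poly_alg Y\<^esub> y = x + y"
  "c \<odot>\<^bsub>poly_alg Y\<^esub> x = cst c * x"
  by (simp_all add: poly_alg_def)

lemma keys_add_closed:
  assumes "Poly_Mapping.keys p \<subseteq> mons Y" "Poly_Mapping.keys q \<subseteq> mons Y"
  shows "Poly_Mapping.keys (p + q) \<subseteq> mons Y"
  using keys_add[of p q] assms by blast

lemma keys_mult_closed:
  fixes p q :: "('y, 'k::comm_ring_1) mpoly"
  assumes "Poly_Mapping.keys p \<subseteq> mons Y" "Poly_Mapping.keys q \<subseteq> mons Y"
  shows "Poly_Mapping.keys (p * q) \<subseteq> mons Y"
proof
  fix u assume "u \<in> Poly_Mapping.keys (p * q)"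
  then obtain a b where "u = a + b" "a \<in> Poly_Mapping.keys p" "b \<in> Poly_Mapping.keys q"
    using keys_mult[of p q] by blast
  then show "u \<in> mons Y" using assms by (auto simp: mons_def)
qed

lemma keys_single_closed: "set_mset u \<subseteq> Y \<Longrightarrow> Poly_Mapping.keys (Poly_Mapping.single u c) \<subseteq> mons Y"
  by (auto simp: mons_def)

lemma keys_sum_closed:
  "(\<And>i. i \<in> A \<Longrightarrow> Poly_Mapping.keys (f i) \<subseteq> mons Y) \<Longrightarrow> Poly_Mapping.keys (sum f A) \<subseteq> mons Y"
  using keys_sum[of f A] by blast

lemma cring_poly_alg: "cring (poly_alg Y :: ('k::comm_ring_1, ('y, 'k) mpoly) module)"
proof (intro cringI abelian_groupI comm_monoidI)
  fix x assume "x \<in> carrier (poly_alg Y :: ('k, ('y, 'k) mpoly) module)"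
  then show "\<exists>y\<in>carrier (poly_alg Y :: ('k, ('y, 'k) mpoly) module).
      y \<oplus>\<^bsub>poly_alg Y\<^esub> x = \<zero>\<^bsub>poly_alg Y\<^esub>"
    by (intro bexI[of _ "- x"]) auto
qed (simp_all add: keys_add_closed keys_mult_closed algebra_simps,
     simp_all add: mons_def)

lemma mult_cst_cst: "cst (a * b) * p = cst a * (cst b * p)"
  by (simp add: mult_single flip: mult.assoc)

lemma algebra_poly_alg:
  "algebra ring_of_type_algebra (poly_alg Y :: ('k::field, ('y, 'k) mpoly) module)"
proof (rule algebraI)
  fix a :: 'k and x :: "('y, 'k) mpoly"
  assume "x \<in> carrier (poly_alg Y :: ('k, ('y, 'k) mpoly) module)"
  then show "a \<odot>\<^bsub>poly_alg Y\<^esub> x \<in> carrier (poly_alg Y :: ('k, ('y, 'k) mpoly) module)"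
    using keys_mult_closed[of "cst a" Y x] keys_single_closed[of "{#}" Y a] by simp
next
  show "cring (ring_of_type_algebra :: 'k ring)" by (rule cring_from_type_algebra)
qed (simp_all add: cring_poly_alg ring_of_type_algebra_def
        distrib_left distrib_right single_add mult_cst_cst mult.assoc)

lemma mpoly_as_sum:
  "p = (\<Sum>u\<in>Poly_Mapping.keys p. cst (Poly_Mapping.lookup p u) * mon u)" for p :: "('y, 'k::comm_ring_1) mpoly"
proof (rule poly_mapping_eqI)
  fix v
  have "Poly_Mapping.lookup (\<Sum>u\<in>Poly_Mapping.keys p. cst (Poly_Mapping.lookup p u) * mon u) v =
      (\<Sum>u\<in>Poly_Mapping.keys p. if u = v then Poly_Mapping.lookup p u else 0)"
    by (simp add: lookup_sum mult_single lookup_single when_def)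
  also have "\<dots> = Poly_Mapping.lookup p v"
    by (simp add: in_keys_iff)
  finally show "Poly_Mapping.lookup p v = Poly_Mapping.lookup (\<Sum>u\<in>Poly_Mapping.keys p. cst (Poly_Mapping.lookup p u) * mon u) v" by simp
qed

lemma der_word_append:
  "der_word lam (xs @ ys) =
     der_word lam xs * mon (mset ys) + mon (mset xs) * der_word lam ys +
     cst lam * (der_word lam xs * der_word lam ys)"
proof (induction xs)
  case Nil
  then show ?case by simp
next
  case (Cons a xs)
  obtain n x where a: "a = (n, x)" by fastforce
  have 1: "mon (mset (xs @ ys)) = (mon (mset xs) * mon (mset ys) :: (nat \<times> 'a, 'b) mpoly)"
    by (simp add: mult_single)
  have 2: "mon (mset (a # xs)) = (mon {#a#} * mon (mset xs) :: (nat \<times> 'a, 'b) mpoly)"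
    by (simp add: mult_single)
  show ?case
    unfolding append_Cons a der_word.simps Cons.IH 1 2[unfolded a]
    by (simp only: algebra_simps)
qed

lemma der_word_cong:
  assumes "mset xs = mset ys"
  shows "der_word lam xs = der_word lam ys"
  using assms
proof (induction xs arbitrary: ys)
  case Nil
  then show ?case by simp
next
  case (Cons a xs)
  then have "a \<in> set ys"
    by (metis list.set_intros(1) set_mset_mset)
  then obtain as bs where ys: "ys = as @ a # bs"
    by (meson split_list)
  then have eq: "mset xs = mset (as @ bs)" using Cons.prems by simp
  then have IH: "der_word lam xs = der_word lam (as @ bs)" by (rule Cons.IH)
  obtain n x where a: "a = (n, x)" by fastforce
  have m: "mon (mset xs) = (mon (mset as) * mon (mset bs) :: (nat \<times> 'a, 'b) mpoly)"
    unfolding eq by (simp add: mult_single)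
  have m2: "mon (mset (a # bs)) = (mon {#a#} * mon (mset bs) :: (nat \<times> 'a, 'b) mpoly)"
    by (simp add: mult_single)
  show ?case
    unfolding ys a der_word.simps m IH der_word_append[of _ as] m2[unfolded a]
    by (simp only: algebra_simps)
qed

lemma der_eq_sum:
  assumes "finite A" "Poly_Mapping.keys p \<subseteq> A"
  shows "der lam p = (\<Sum>u\<in>A. cst (Poly_Mapping.lookup p u) * der_word lam (sorted_list_of_multiset u))"
  unfolding der_def
  by (rule sum.mono_neutral_left) (use assms in \<open>auto simp: in_keys_iff\<close>)

lemma der_add: "der lam (p + q) = der lam p + der lam q"
proof -
  let ?A = "Poly_Mapping.keys p \<union> Poly_Mapping.keys q"
  have "der lam (p + q) =
      (\<Sum>u\<in>?A. cst (Poly_Mapping.lookup (p + q) u) * der_word lam (sorted_list_of_multiset u))"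
    by (rule der_eq_sum) (use keys_add[of p q] in auto)
  also have "\<dots> = der lam p + der lam q"
    by (simp add: der_eq_sum[of ?A p] der_eq_sum[of ?A q] lookup_add single_add
        distrib_right sum.distrib)
  finally show ?thesis .
qed

lemma der_zero [simp]: "der lam 0 = 0"
  by (simp add: der_def)

lemma der_sum: "der lam (sum f A) = (\<Sum>i\<in>A. der lam (f i))"
  by (induction A rule: infinite_finite_induct) (simp_all add: der_add)

lemma der_single:
  "der lam (Poly_Mapping.single u c) = cst c * der_word lam (sorted_list_of_multiset u)"
  by (subst der_eq_sum[of "{u}"]) auto

lemma der_cst_mult:
  fixes p :: "(nat \<times> 'x::linorder, 'k::comm_ring_1) mpoly"
  shows "der lam (cst c * p) = cst c * der lam p"
proof -
  have "der lam (cst c * p) = der lam (\<Sum>u\<in>Poly_Mapping.keys p. Poly_Mapping.single u (c * Poly_Mapping.lookup p u))"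
    by (subst (1) mpoly_as_sum[of p]) (simp add: sum_distrib_left mult_single)
  also have "\<dots> = cst c * der lam p"
    by (simp add: der_sum der_single der_def[of lam p] sum_distrib_left mult_cst_cst)
  finally show ?thesis .
qed

lemma der_mon_mult:
  "der lam (mon u * mon v) =
     der lam (mon u) * mon v + mon u * der lam (mon v) +
     cst lam * (der lam (mon u) * der lam (mon v))"
proof -
  have "der_word lam (sorted_list_of_multiset (u + v)) =
      der_word lam (sorted_list_of_multiset u @ sorted_list_of_multiset v)"
    by (rule der_word_cong) simp
  then show ?thesis
    by (simp add: der_single mult_single der_word_append)
qed

lemma der_mult:
  fixes p q :: "(nat \<times> 'x::linorder, 'k::comm_ring_1) mpoly"
  shows "der lam (p * q) = der lam p * q + p * der lam q + cst lam * (der lam p * der lam q)"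
proof -
  let ?L = "\<lambda>p q. der lam (p * q)"
  let ?R = "\<lambda>p q. der lam p * q + p * der lam q + cst lam * (der lam p * der lam q)"
  have mon_case: "?L (cst a * mon u) (cst b * mon v) = ?R (cst a * mon u) (cst b * mon v)"
    for a b u v
  proof -
    have "?L (cst a * mon u) (cst b * mon v) = der lam (cst a * (cst b * (mon u * mon v)))"
      by (simp only: ac_simps)
    then show ?thesis
      unfolding der_cst_mult der_mon_mult by (simp only: algebra_simps)
  qed
  have sum_left: "?L (sum f A) s = ?R (sum f A) s" if "\<And>i. ?L (f i) s = ?R (f i) s"
    for f and s :: "(nat \<times> 'x, 'k) mpoly" and A :: "(nat \<times> 'x) multiset set"
    by (simp add: sum_distrib_right sum_distrib_left der_sum that sum.distrib)
  have sum_right: "?L s (sum f A) = ?R s (sum f A)" if "\<And>i. ?L s (f i) = ?R s (f i)"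
    for f and s :: "(nat \<times> 'x, 'k) mpoly" and A :: "(nat \<times> 'x) multiset set"
    by (simp add: sum_distrib_right sum_distrib_left der_sum that sum.distrib)
  have "?L (\<Sum>u\<in>Poly_Mapping.keys p. cst (Poly_Mapping.lookup p u) * mon u) (\<Sum>v\<in>Poly_Mapping.keys q. cst (Poly_Mapping.lookup q v) * mon v) =
      ?R (\<Sum>u\<in>Poly_Mapping.keys p. cst (Poly_Mapping.lookup p u) * mon u) (\<Sum>v\<in>Poly_Mapping.keys q. cst (Poly_Mapping.lookup q v) * mon v)"
    by (intro sum_left sum_right mon_case)
  then show ?thesis
    by (simp only: mpoly_as_sum[symmetric])
qed

lemma keys_der_word:
  "set xs \<subseteq> Delta Xs \<Longrightarrow> Poly_Mapping.keys (der_word lam xs) \<subseteq> mons (Delta Xs)"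
proof (induction lam xs rule: der_word.induct)
  case (2 lam n x ys)
  then show ?case
    unfolding der_word.simps
    by (intro keys_add_closed keys_mult_closed keys_single_closed) (auto simp: Delta_def)
qed simp

lemma keys_der:
  assumes "Poly_Mapping.keys p \<subseteq> mons (Delta Xs)"
  shows "Poly_Mapping.keys (der lam p) \<subseteq> mons (Delta Xs)"
  unfolding der_def using assms
  by (intro keys_sum_closed keys_mult_closed keys_single_closed keys_der_word)
     (auto simp: mons_def)

theorem der_characterization:
  fixes lam :: "'k::field" and Xs :: "'x::linorder set"
  defines "P \<equiv> poly_alg (Delta Xs)"
  shows "comm_diff_algebra P lam (der lam)"
    and "der lam (mon {#(n, x)#}) = mon {#(Suc n, x)#}"
    and "comm_diff_algebra P lam D \<Longrightarrow>
           (\<And>n x. x \<in> Xs \<Longrightarrow> D (mon {#(n, x)#}) = mon {#(Suc n, x)#}) \<Longrightarrow>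
           p \<in> carrier P \<Longrightarrow> D p = der lam p"
proof -
  show "comm_diff_algebra P lam (der lam)"
    unfolding P_def comm_diff_algebra_def comm_diff_algebra_axioms_def
    using der_single[of lam "{#} :: (nat \<times> 'x) multiset"]
      der_single[of lam "{#} :: (nat \<times> 'x) multiset" 1]
    by (simp add: algebra_poly_alg der_add der_cst_mult der_mult keys_der)
  show "der lam (mon {#(n, x)#}) = mon {#(Suc n, x)#}"
    by (simp add: der_single)
  assume D: "comm_diff_algebra P lam D"
    and var: "\<And>n x. x \<in> Xs \<Longrightarrow> D (mon {#(n, x)#}) = mon {#(Suc n, x)#}"
    and p: "p \<in> carrier P"
  note D' = comm_diff_algebra.d_add[OF D] comm_diff_algebra.d_smult[OF D]
    comm_diff_algebra.d_mult[OF D] comm_diff_algebra.d_one[OF D]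
  have D_word: "D (mon (mset xs)) = der_word lam xs" if "set xs \<subseteq> Delta Xs" for xs
    using that
  proof (induction xs)
    case Nil
    then show ?case using D'(4) by (simp add: P_def)
  next
    case (Cons a xs)
    obtain n x where a: "a = (n, x)" by fastforce
    then have x: "x \<in> Xs" using Cons.prems by (auto simp: Delta_def)
    have "D (mon {#a#} * mon (mset xs)) = der_word lam (a # xs)"
      using D'(3)[of "mon {#a#}" "mon (mset xs)"] Cons var[OF x, of n]
      by (simp add: P_def a mons_def)
    then show ?case by (simp add: mult_single)
  qed
  have "D (\<Sum>u\<in>A. cst (Poly_Mapping.lookup p u) * mon u) =
      (\<Sum>u\<in>A. cst (Poly_Mapping.lookup p u) * der_word lam (sorted_list_of_multiset u))"
    if "finite A" "A \<subseteq> mons (Delta Xs)" for A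
    using that
  proof (induction A rule: finite_induct)
    case empty
    have "D 0 = 0" using D'(2)[of 0 0] by (simp add: P_def)
    then show ?case by simp
  next
    case (insert u A)
    have u: "set_mset u \<subseteq> Delta Xs" using insert.prems by (simp add: mons_def)
    have 1: "D (cst (Poly_Mapping.lookup p u) * mon u) =
        cst (Poly_Mapping.lookup p u) * der_word lam (sorted_list_of_multiset u)"
      using D'(2)[of "mon u"] D_word[of "sorted_list_of_multiset u"] u
      by (simp add: P_def mons_def)
    have c1: "Poly_Mapping.keys (cst (Poly_Mapping.lookup p u) * mon u) \<subseteq> mons (Delta Xs)"
      using u by (intro keys_mult_closed keys_single_closed) auto
    have c2: "Poly_Mapping.keys (\<Sum>u\<in>A. cst (Poly_Mapping.lookup p u) * mon u) \<subseteq> mons (Delta Xs)"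
      using insert.prems
      by (intro keys_sum_closed keys_mult_closed keys_single_closed) (auto simp: mons_def)
    show ?case
      using D'(1)[of "cst (Poly_Mapping.lookup p u) * mon u" "\<Sum>u\<in>A. cst (Poly_Mapping.lookup p u) * mon u"]
        c1 c2 1 insert by (simp add: P_def)
  qed
  from this[of "Poly_Mapping.keys p"] show "D p = der lam p"
    using p by (simp add: P_def der_def flip: mpoly_as_sum)
qed

end

(*
  For lam \<noteq> 0 the Leibniz rule of weight lam shows that the leading monomial of d(u) is obtained
  from the word u by raising the order of every letter by one, with coefficient lam^(|u| - 1).
  Hence all letters of the leading monomial of d^i(f), f in k[X], have order i, and two such
  leading monomials overlap only if the orders i = j agree.  In that case the composition is, up
  to a nonzero scalar and terms with smaller leading monomials, d^i of the corresponding
  composition in k[X], and d^i maps a sum with leading monomials below w to one with leading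
  monomials below the i-fold raised w.

  The universal property holds for every weight: a homomorphism on k[X]/I_A determines the values
  on the letters of order 0, hence on all letters, and the kernel of the resulting homomorphism on
  k[Delta(X)] is a differential ideal containing the generators.
*)

theory Submission
  imports Defs
begin

text \<open>Raising letters is compatible with products, but the accompanying powers of
  \<open>lam\<close> are not. Up to smaller terms, \<open>(der lam ^^ i) (p * mon a)\<close> is
  \<open>(der lam ^^ i) p\<close> times the raised \<open>a\<close>, scaled by
  \<open>lam ^ (size a * i)\<close>, and this scalar may differ for the two halves of a composition.
  Normalizing \<open>(der lam ^^ i) p\<close> removes a further
  \<open>lam ^ ((size (lm p) - 1) * i)\<close>. The two exponents add up to
  \<open>(size w0 - 1) * i\<close>, where \<open>w0\<close> is the least common multiple of the
  leading monomials in k[X], so one scalar serves both halves. This count fails for constants, which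
  \<open>der\<close> kills, but the size bound on \<open>w\<close> keeps empty leading monomials out
  of every composition. The part of \<open>w\<close> outside the raised \<open>w0\<close> may
  contain letters of any order; it is never differentiated and is multiplied on at the end.\<close>

section \<open>The deg-lex order\<close>

definition deglex_eq :: "'y::linorder multiset \<Rightarrow> 'y multiset \<Rightarrow> bool" (infix \<open>\<preceq>\<close> 50) where
  "u \<preceq> v \<longleftrightarrow> u = v \<or> u \<prec> v"

text \<open>For decreasing words of equal length this is the lexicographic order, read off at the
  largest letter whose multiplicities differ. In this form translation invariance is cancellation of
  multiplicities and needs no sorting.\<close>

definition count_less :: "'y::linorder multiset \<Rightarrow> 'y multiset \<Rightarrow> bool" where
  "count_less u v \<longleftrightarrow> (\<exists>a. count u a < count v a \<and> (\<forall>b>a. count u b = count v b))"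

lemma count_less_irrefl: "\<not> count_less u u"
  by (simp add: count_less_def)

lemma count_less_trans:
  assumes "count_less u v" "count_less v w"
  shows "count_less u w"
proof -
  obtain a b where a: "count u a < count v a" "\<forall>c>a. count u c = count v c"
    and b: "count v b < count w b" "\<forall>c>b. count v c = count w c"
    using assms by (auto simp: count_less_def)
  \<comment> \<open>Above both deciding letters the three multisets agree. At the larger of the two,
    one comparison is strict and the other is strict or an equality.\<close>
  have "count u (max a b) < count w (max a b) \<and> (\<forall>c>max a b. count u c = count w c)"
    using a b by (cases a b rule: linorder_cases) (auto simp: max_def)
  then show ?thesis
    unfolding count_less_def by blast
qed

lemma count_less_total:
  assumes "u \<noteq> v"
  shows "count_less u v \<or> count_less v u"
proof -
  let ?A = "{a. count u a \<noteq> count v a}"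
  have "?A \<subseteq> set_mset u \<union> set_mset v"
    by (rule subsetI, rule ccontr) (simp add: not_in_iff)
  then have fin: "finite ?A"
    by (rule finite_subset) simp
  moreover have "?A \<noteq> {}"
    using assms by (auto simp: multiset_eq_iff)
  ultimately have "Max ?A \<in> ?A"
    by (rule Max_in)
  moreover have "count u b = count v b" if "b > Max ?A" for b
    using Max_ge[OF fin, of b] that by force
  ultimately show ?thesis
    unfolding count_less_def by (metis (mono_tags, lifting) linorder_neqE_nat mem_Collect_eq)
qed

text \<open>After the common prefix, the first difference \<open>x < y\<close> makes
  \<open>y\<close> the deciding letter: the rest of the smaller word stays at or below
  \<open>x\<close>, and no letter above \<open>y\<close> occurs in either rest.\<close>

lemma count_less_if_lex:
  fixes xs ys :: "'y::linorder list"
  assumes "sorted_wrt (\<ge>) xs" "(xs, ys) \<in> lex {(a, b). a < b}"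
  shows "count_less (mset xs) (mset ys) \<or> \<not> sorted_wrt (\<ge>) ys"
proof -
  obtain zs x y xs' ys' where xs: "xs = zs @ x # xs'" and ys: "ys = zs @ y # ys'" and "x < y"
    using assms(2) by (auto simp: lex_conv)
  have xs': "count (mset xs') b = 0" if "b \<ge> y" for b
    using assms(1) \<open>x < y\<close> that by (force simp: xs sorted_wrt_append count_eq_zero_iff)
  have "count (mset ys') b = 0" if "b > y" "sorted_wrt (\<ge>) ys" for b
    using that by (force simp: ys sorted_wrt_append count_eq_zero_iff)
  note ys' = this
  have "count (mset xs) y < count (mset ys) y"
    using xs'[of y] \<open>x < y\<close> by (auto simp: xs ys simp del: count_mset_0_iff)
  moreover have "count (mset xs) b = count (mset ys) b" if "b > y" "sorted_wrt (\<ge>) ys" for b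
    using xs'[of b] ys'[OF that] that(1) \<open>x < y\<close> by (auto simp: xs ys simp del: count_mset_0_iff)
  ultimately show ?thesis
    unfolding count_less_def by blast
qed

lemma deglex_iff:
  "u \<prec> v \<longleftrightarrow> size u < size v \<or> size u = size v \<and> count_less u v"
proof -
  let ?l = "\<lambda>u :: 'a multiset. rev (sorted_list_of_multiset u)"
  let ?lex = "lex {(a, b). a < (b :: 'a)}"
  have len: "length (?l w) = size w" for w
    by (metis length_rev mset_sorted_list_of_multiset size_mset)
  have sorted: "sorted_wrt (\<ge>) (?l w)" for w
    by (simp add: sorted_wrt_rev)
  have lex: "count_less w1 w2" if "(?l w1, ?l w2) \<in> ?lex" for w1 w2
    using count_less_if_lex[OF sorted that] sorted[of w2] by simp
  \<comment> \<open>The converse comes from totality of \<open>lenlex\<close>: the two words differ,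
    and if they were related the other way round, \<open>lex\<close> would contradict irreflexivity
    and transitivity of \<open>count_less\<close>.\<close>
  have "(?l u, ?l v) \<in> ?lex" if "count_less u v" "size u = size v"
  proof -
    have "?l u \<noteq> ?l v"
      using that count_less_irrefl by (metis mset_sorted_list_of_multiset rev_is_rev_conv)
    moreover have "total (lenlex {(a, b). a < (b :: 'a)})"
      by (rule total_lenlex) (auto simp: total_on_def)
    ultimately have "(?l u, ?l v) \<in> lenlex {(a, b). a < b} \<or> (?l v, ?l u) \<in> lenlex {(a, b). a < b}"
      by (simp add: total_on_def)
    then have "(?l u, ?l v) \<in> ?lex \<or> (?l v, ?l u) \<in> ?lex"
      unfolding lenlex_conv using len that(2) by auto
    then show ?thesis
      using that lex count_less_irrefl count_less_trans by blast
  qed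
  then show ?thesis
    unfolding deglex_def lenlex_conv using lex len by auto
qed

interpretation deglex: linorder "(\<preceq>)" "(\<prec>)"
proof
  fix u v w :: "'a multiset"
  show "u \<prec> v \<longleftrightarrow> u \<preceq> v \<and> \<not> v \<preceq> u"
    using count_less_irrefl count_less_trans by (fastforce simp: deglex_eq_def deglex_iff)
  show "u \<preceq> u"
    by (simp add: deglex_eq_def)
  show "u \<preceq> w" if "u \<preceq> v" "v \<preceq> w"
    using that count_less_trans by (auto simp: deglex_eq_def deglex_iff)
  show "u = v" if "u \<preceq> v" "v \<preceq> u"
    using that count_less_irrefl count_less_trans by (fastforce simp: deglex_eq_def deglex_iff)
  show "u \<preceq> v \<or> v \<preceq> u"
    using count_less_total[of u v] by (auto simp: deglex_eq_def deglex_iff)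
qed

lemma deglex_add_left_iff [simp]: "w + u \<prec> w + v \<longleftrightarrow> u \<prec> v"
  by (simp add: deglex_iff count_less_def)

lemma deglex_add_right_iff [simp]: "u + w \<prec> v + w \<longleftrightarrow> u \<prec> v"
  by (simp add: deglex_iff count_less_def)

lemma deglex_eq_add_left_iff [simp]: "w + u \<preceq> w + v \<longleftrightarrow> u \<preceq> v"
  by (simp add: deglex_eq_def)

lemma deglex_eq_add_right_iff [simp]: "u + w \<preceq> v + w \<longleftrightarrow> u \<preceq> v"
  by (simp add: deglex_eq_def)

lemma deglex_add_mono: "u \<preceq> u' \<Longrightarrow> v \<preceq> v' \<Longrightarrow> u + v \<preceq> u' + v'"
  by (metis deglex.order_trans deglex_eq_add_left_iff deglex_eq_add_right_iff)

lemma deglex_add_less_le: "u \<prec> u' \<Longrightarrow> v \<preceq> v' \<Longrightarrow> u + v \<prec> u' + v'"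
  by (metis deglex.less_le_trans deglex_add_right_iff deglex_eq_add_left_iff)

lemma deglex_add_le_less: "u \<preceq> u' \<Longrightarrow> v \<prec> v' \<Longrightarrow> u + v \<prec> u' + v'"
  by (metis deglex_add_less_le add.commute)

section \<open>Monotone renaming of letters\<close>

lemma count_image_mset_strict_mono:
  fixes f :: "'a::linorder \<Rightarrow> 'b::order"
  assumes "strict_mono f"
  shows "count (image_mset f u) (f a) = count u a"
  using assms by (induction u) (auto simp: strict_mono_eq)

text \<open>The image of the deciding letter decides again, since letters outside the range of
  \<open>f\<close> have multiplicity 0 on both sides. Both the embedding at a fixed order and the
  raising of orders are instances.\<close>

lemma deglex_image_mset:
  fixes f :: "'a::linorder \<Rightarrow> 'b::linorder"
  assumes "strict_mono f" "u \<prec> v"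
  shows "image_mset f u \<prec> image_mset f v"
proof -
  have "count_less (image_mset f u) (image_mset f v)" if less: "count_less u v"
  proof -
    obtain a where a: "count u a < count v a" "\<forall>b>a. count u b = count v b"
      using less unfolding count_less_def by blast
    have "count (image_mset f u) c = count (image_mset f v) c" if "c > f a" for c
    proof (cases "c \<in> range f")
      case True
      then show ?thesis
        using a that assms(1)
        by (auto simp: count_image_mset_strict_mono strict_mono_less)
    next
      case False
      then have "count (image_mset f w) c = 0" for w
        by (auto simp: count_eq_zero_iff)
      then show ?thesis
        by simp
    qed
    then show ?thesis
      unfolding count_less_def using a(1) count_image_mset_strict_mono[OF assms(1)] by metis
  qed
  then show ?thesis
    using assms(2) by (auto simp: deglex_iff)
qed


section \<open>Leading monomials\<close>

text \<open>The coefficient \<open>c\<close> may be 0, and then every monomial of \<open>f\<close>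
  is strictly below \<open>w\<close>. This makes the notion stable under sums, products and
  derivation without a case distinction on cancellation; it determines \<open>lm\<close> as soon as
  \<open>c\<close> is nonzero.\<close>

definition leads :: "'y::linorder multiset \<Rightarrow> 'k::zero \<Rightarrow> ('y, 'k) mpoly \<Rightarrow> bool" where
  "leads w c f \<longleftrightarrow> Poly_Mapping.lookup f w = c \<and> (\<forall>v\<in>Poly_Mapping.keys f. v \<preceq> w)"

lemma leads_nonzero: "leads w c f \<Longrightarrow> c \<noteq> 0 \<Longrightarrow> f \<noteq> 0"
  by (auto simp: leads_def)

lemma lm_eqI:
  assumes "leads w c f" "c \<noteq> 0"
  shows "lm f = w"
proof -
  have "w \<in> Poly_Mapping.keys f"
    using assms by (auto simp: leads_def in_keys_iff)
  then show ?thesis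
    unfolding lm_def using assms(1)
    by (intro the_equality) (auto simp: leads_def intro: deglex.order.antisym simp flip: deglex_eq_def)
qed

lemma lc_eqI: "leads w c f \<Longrightarrow> c \<noteq> 0 \<Longrightarrow> lc f = c"
  using lm_eqI[of w c f] by (auto simp: lc_def leads_def)

text \<open>The support is finite and nonempty, so it has a maximum for the linear order; this
  justifies the definite description in \<open>lm\<close>.\<close>

lemma leads_lm:
  assumes "f \<noteq> 0"
  shows "leads (lm f) (lc f) f" "lc f \<noteq> 0"
proof -
  let ?K = "Poly_Mapping.keys f"
  have K: "finite ?K" "?K \<noteq> {}"
    using assms by auto
  let ?w = "deglex.Max ?K"
  have w: "?w \<in> ?K" and "\<forall>v\<in>?K. v \<preceq> ?w"
    using K deglex.Max_in[OF K] deglex.Max_ge[OF K(1)] by auto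
  then have "leads ?w (Poly_Mapping.lookup f ?w) f" and "Poly_Mapping.lookup f ?w \<noteq> 0"
    by (auto simp: leads_def in_keys_iff)
  then show "leads (lm f) (lc f) f" "lc f \<noteq> 0"
    using lm_eqI[of ?w _ f] lc_eqI[of ?w _ f] by simp_all
qed

lemma lm_in_keys: "f \<noteq> 0 \<Longrightarrow> lm f \<in> Poly_Mapping.keys f"
  using leads_lm[of f] by (auto simp: leads_def in_keys_iff)


lemma leads_zero: "leads w 0 0"
  by (simp add: leads_def)

lemma leads_single: "leads w c (Poly_Mapping.single w c)"
  by (simp add: leads_def)

lemma leads_add: "leads w c f \<Longrightarrow> leads w e g \<Longrightarrow> leads w (c + e) (f + g)"
  using keys_add[of f g] by (auto simp: leads_def lookup_add)

lemma leads_weaken: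
  assumes "leads v c f" "v \<prec> w"
  shows "leads w 0 f"
proof -
  have "u \<prec> w" if "u \<in> Poly_Mapping.keys f" for u
    using assms that by (auto simp: leads_def intro: deglex.le_less_trans)
  then show ?thesis
    by (force simp: leads_def deglex_eq_def in_keys_iff)
qed

text \<open>With the head terms split off, every other product of monomials has a factor strictly
  below its bound, and translation invariance keeps it strictly below \<open>v + w\<close>.\<close>

lemma leads_mult:
  fixes f g :: "('y::linorder, 'k::comm_ring_1) mpoly"
  assumes f: "leads v c f" and g: "leads w e g"
  shows "leads (v + w) (c * e) (f * g)"
proof -
  define f' g' where "f' = f - Poly_Mapping.single v c" and "g' = g - Poly_Mapping.single w e"
  have below: "\<forall>u\<in>Poly_Mapping.keys (h - Poly_Mapping.single x a). u \<prec> x"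
    if "leads x a h" for x :: "'y multiset" and a :: 'k and h
    using that by (auto simp: leads_def deglex_eq_def in_keys_iff lookup_minus lookup_single when_def split: if_splits)
  have f': "\<forall>u\<in>Poly_Mapping.keys f'. u \<prec> v" and g': "\<forall>u\<in>Poly_Mapping.keys g'. u \<prec> w"
    unfolding f'_def g'_def using below f g by blast+
  have prod: "leads (v + w) 0 (h1 * h2)"
    if "\<forall>a\<in>Poly_Mapping.keys h1. \<forall>b\<in>Poly_Mapping.keys h2. a + b \<prec> v + w" for h1 h2 :: "('y, 'k) mpoly"
  proof -
    have "\<forall>u\<in>Poly_Mapping.keys (h1 * h2). u \<prec> v + w"
      using that keys_mult[of h1 h2] by blast
    then show ?thesis
      by (force simp: leads_def deglex_eq_def in_keys_iff)
  qed
  have "leads (v + w) 0 (f' * g)"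
    using f' g by (intro prod) (auto simp: leads_def intro: deglex_add_less_le)
  moreover have "leads (v + w) 0 (Poly_Mapping.single v c * g')"
    using g' by (intro prod) (auto split: if_splits)
  moreover have "f * g = f' * g + Poly_Mapping.single v c * g' + Poly_Mapping.single (v + w) (c * e)"
    by (simp add: f'_def g'_def algebra_simps mult_single)
  ultimately show ?thesis
    using leads_add[OF leads_add leads_single, of "v + w" 0 _ 0 _ "c * e"] by simp
qed

lemma leads_cst_mult: "leads w e f \<Longrightarrow> leads w (c * e) (cst c * f)"
  for f :: "('y::linorder, 'k::comm_ring_1) mpoly"
  using leads_mult[OF leads_single, of w e f "{#}" c] by simp

lemma leads_sum:
  assumes "\<And>i. i \<in> A \<Longrightarrow> leads w (c i) (f i)"
  shows "leads w (sum c A) (sum f A)"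
  using assms by (induction A rule: infinite_finite_induct) (auto intro: leads_zero leads_add)

text \<open>The zero polynomial needs no case of its own, as it is a single term with coefficient
  0.\<close>

lemma mpoly_induct [consumes 1, case_names single add]:
  fixes p :: "('y, 'k::comm_ring_1) mpoly"
  assumes "Poly_Mapping.keys p \<subseteq> mons Y"
    and single: "\<And>u c. u \<in> mons Y \<Longrightarrow> P (Poly_Mapping.single u c)"
    and add: "\<And>p q. Poly_Mapping.keys p \<subseteq> mons Y \<Longrightarrow> Poly_Mapping.keys q \<subseteq> mons Y \<Longrightarrow>
      P p \<Longrightarrow> P q \<Longrightarrow> P (p + q)"
  shows "P p"
proof -
  have "P (\<Sum>u\<in>A. Poly_Mapping.single u (Poly_Mapping.lookup p u))"
    if "finite A" "A \<subseteq> mons Y" for A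
    using that
  proof (induction A rule: finite_induct)
    case empty
    then show ?case
      using single[of "{#}" 0] by (simp add: mons_def)
  next
    case (insert u A)
    then show ?case
      by (auto simp: mons_def intro!: add single keys_sum_closed keys_single_closed)
  qed
  then have "P (\<Sum>u\<in>Poly_Mapping.keys p. cst (Poly_Mapping.lookup p u) * mon u)"
    using assms(1) by (simp add: mult_single)
  then show ?thesis
    by (simp only: mpoly_as_sum[symmetric])
qed

lemma mons_UNIV: "mons UNIV = UNIV"
  by (simp add: mons_def)

section \<open>The embedding of \<open>k[X]\<close>\<close>

lemma i_hat_eq_sum:
  assumes "finite A" "Poly_Mapping.keys p \<subseteq> A"
  shows "i_hat p = (\<Sum>u\<in>A. Poly_Mapping.single (image_mset (Pair 0) u) (Poly_Mapping.lookup p u))"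
  unfolding i_hat_def
  by (rule sum.mono_neutral_left) (use assms in \<open>auto simp: in_keys_iff\<close>)

lemma i_hat_add: "i_hat (p + q) = i_hat p + i_hat q"
proof -
  let ?A = "Poly_Mapping.keys p \<union> Poly_Mapping.keys q"
  show ?thesis
    by (simp add: i_hat_eq_sum[of ?A p] i_hat_eq_sum[of ?A q] i_hat_eq_sum[of ?A "p + q"]
        keys_add lookup_add single_add sum.distrib)
qed

lemma i_hat_single [simp]:
  "i_hat (Poly_Mapping.single u c) = Poly_Mapping.single (image_mset (Pair 0) u) c"
  by (subst i_hat_eq_sum[of "{u}"]) auto

lemma i_hat_one [simp]: "i_hat 1 = 1"
  using i_hat_single[of "{#}" 1] by (simp del: i_hat_single)

lemma i_hat_zero [simp]: "i_hat 0 = 0"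
  by (simp add: i_hat_def)

lemma i_hat_mult:
  fixes p q :: "('x, 'k::comm_ring_1) mpoly"
  shows "i_hat (p * q) = i_hat p * i_hat q"
proof -
  have "Poly_Mapping.keys p \<subseteq> mons UNIV" and "Poly_Mapping.keys q \<subseteq> mons UNIV"
    by (simp_all add: mons_UNIV)
  then show ?thesis
  proof (induction p rule: mpoly_induct)
    case (single u c)
    from single(2) show ?case
      by (induction q rule: mpoly_induct) (simp_all add: mult_single i_hat_add distrib_left)
  qed (simp add: i_hat_add distrib_right)
qed

lemma i_hat_diff: "i_hat (p - q) = i_hat p - i_hat q"
  using i_hat_add[of "p - q" q] by simp

lemma lookup_i_hat:
  fixes p :: "('x, 'k::comm_ring_1) mpoly"
  shows "Poly_Mapping.lookup (i_hat p) (image_mset (Pair 0) u) = Poly_Mapping.lookup p u"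
proof -
  have inj: "image_mset (Pair (0 :: nat)) v = image_mset (Pair 0) u \<longleftrightarrow> v = u" for v :: "'x multiset"
    using multiset.inj_map[of "Pair (0 :: nat)"] by (auto simp: inj_on_def)
  have "Poly_Mapping.lookup (i_hat p) (image_mset (Pair 0) u) =
      (\<Sum>v\<in>Poly_Mapping.keys p. if v = u then Poly_Mapping.lookup p v else 0)"
    by (simp add: i_hat_def lookup_sum lookup_single when_def inj)
  then show ?thesis
    by (simp add: in_keys_iff)
qed

lemma keys_i_hat: "Poly_Mapping.keys (i_hat p) \<subseteq> image_mset (Pair 0) ` Poly_Mapping.keys p"
  unfolding i_hat_def using keys_sum by (fastforce split: if_splits)

lemma image_mset_Pair_mons: "u \<in> mons Xs \<Longrightarrow> image_mset (Pair n) u \<in> mons (Delta Xs)"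
  by (auto simp: mons_def Delta_def)

lemma i_hat_closed:
  "Poly_Mapping.keys p \<subseteq> mons Xs \<Longrightarrow> Poly_Mapping.keys (i_hat p) \<subseteq> mons (Delta Xs)"
  using keys_i_hat[of p] image_mset_Pair_mons by blast

lemma strict_mono_Pair: "strict_mono (Pair (n :: nat) :: 'x::linorder \<Rightarrow> _)"
  by (simp add: strict_mono_def less_prod_simp)

lemma deglex_eq_image_mset:
  fixes f :: "'a::linorder \<Rightarrow> 'b::linorder"
  shows "strict_mono f \<Longrightarrow> u \<preceq> v \<Longrightarrow> image_mset f u \<preceq> image_mset f v"
  using deglex_image_mset[of f u v] by (auto simp: deglex_eq_def)

lemma leads_i_hat:
  "leads w c f \<Longrightarrow> leads (image_mset (Pair 0) w) c (i_hat f)"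
  unfolding leads_def using keys_i_hat[of f] deglex_eq_image_mset[OF strict_mono_Pair]
  by (fastforce simp: lookup_i_hat)

section \<open>Leading monomials of derivatives\<close>

abbreviation shift :: "(nat \<times> 'x) multiset \<Rightarrow> (nat \<times> 'x) multiset" where
  "shift \<equiv> image_mset (apfst Suc)"

lemma strict_mono_apfst_Suc: "strict_mono (apfst Suc :: nat \<times> 'x::linorder \<Rightarrow> _)"
  by (auto simp: strict_mono_def less_prod_def)

lemmas shift_less = deglex_image_mset[OF strict_mono_apfst_Suc]

lemma le_shift: "u \<preceq> shift u" for u :: "(nat \<times> 'x::linorder) multiset"
proof (induction u)
  case (add a u)
  have "{#a#} \<prec> shift {#a#}"
    unfolding deglex_iff count_less_def
    by (cases a) (auto simp: less_prod_def intro!: exI[of _ "apfst Suc a"])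
  then have "{#a#} + u \<preceq> shift {#a#} + shift u"
    using add by (intro deglex_add_mono) (auto simp: deglex_eq_def)
  then show ?case
    by simp
qed simp

lemma less_shift:
  fixes u :: "(nat \<times> 'x::linorder) multiset"
  assumes "u \<noteq> {#}"
  shows "u \<prec> shift u"
proof -
  have "u \<noteq> shift u"
  proof
    assume "u = shift u"
    then have "sum_mset (image_mset fst u) = sum_mset (image_mset fst (shift u))"
      by simp
    \<comment> \<open>Each letter adds one to the sum of the orders, so a nonempty word cannot equal
      its shift.\<close>
    also have "\<dots> = sum_mset (image_mset fst u) + size u"
      by (induction u) auto
    finally show False
      using assms by simp
  qed
  then show ?thesis
    using le_shift[of u] by (simp add: deglex_eq_def)
qed

lemma shift_pow_add: "(shift ^^ i) (u + v) = (shift ^^ i) u + (shift ^^ i) v"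
  by (induction i) auto

lemma size_shift_pow [simp]: "size ((shift ^^ i) u) = size u"
  by (induction i) auto

lemma shift_pow_empty_iff [simp]: "(shift ^^ i) u = {#} \<longleftrightarrow> u = {#}"
  by (induction i) auto

lemma shift_pow_empty [simp]: "(shift ^^ i) {#} = {#}"
  by simp

lemma shift_pow_Pair: "(shift ^^ i) (image_mset (Pair 0) u) = image_mset (Pair i) u"
  by (induction i) (auto simp: multiset.map_comp comp_def)

lemma shift_pow_mons: "u \<in> mons (Delta Xs) \<Longrightarrow> (shift ^^ i) u \<in> mons (Delta Xs)"
  by (induction i) (auto simp: mons_def Delta_def)

text \<open>The empty word is treated apart because constants are killed, whereas truncated
  subtraction would give it the coefficient \<open>lam ^ 0 = 1\<close>.\<close>

definition der_coeff :: "'k::comm_ring_1 \<Rightarrow> nat \<Rightarrow> 'k" where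
  "der_coeff lam n = (if n = 0 then 0 else lam ^ (n - 1))"

text \<open>For nonempty \<open>ys\<close>, the first two Leibniz summands leave some letter
  unraised and fall strictly below the bound, so each further letter contributes one factor
  \<open>lam\<close>. For a single letter the weighted summand vanishes and the first summand leads
  with coefficient 1.\<close>

lemma leads_der_word:
  fixes xs :: "(nat \<times> 'x::linorder) list" and lam :: "'k::comm_ring_1"
  shows "leads (shift (mset xs)) (der_coeff lam (length xs)) (der_word lam xs)"
proof (induction lam xs rule: der_word.induct)
  case (1 lam)
  then show ?case
    by (simp add: der_coeff_def leads_zero)
next
  case (2 lam n x ys)
  let ?a = "{#(n, x)#}" and ?a' = "{#(Suc n, x)#}"
  have 1: "leads (?a' + mset ys) (1 * 1) (mon ?a' * mon (mset ys) :: (nat \<times> 'x, 'k) mpoly)"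
    by (intro leads_mult leads_single)
  have 2: "leads (?a + shift (mset ys)) (1 * der_coeff lam (length ys)) (mon ?a * der_word lam ys)"
    by (intro leads_mult leads_single "2.IH")
  have 3: "leads (?a' + shift (mset ys)) (1 * der_coeff lam (length ys)) (mon ?a' * der_word lam ys)"
    by (intro leads_mult leads_single "2.IH")
  show ?case
  proof (cases "ys = []")
    case True
    then show ?thesis
      using leads_single[of ?a' 1] by (simp add: der_coeff_def)
  next
    case False
    then have "?a' + mset ys \<prec> ?a' + shift (mset ys)"
      using less_shift[of "mset ys"] by (simp only: deglex_add_left_iff) simp
    moreover have "?a + shift (mset ys) \<prec> ?a' + shift (mset ys)"
      using less_shift[of ?a] by (simp only: deglex_add_right_iff) simp
    ultimately have "leads (?a' + shift (mset ys))
        (0 + 0 + lam * (1 * der_coeff lam (length ys))) (der_word lam ((n, x) # ys))"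
      unfolding der_word.simps using leads_weaken[OF 1] leads_weaken[OF 2] leads_cst_mult[OF 3]
      by (intro leads_add)
    moreover have "lam * der_coeff lam (length ys) = der_coeff lam (length ((n, x) # ys))"
      using False by (cases ys) (auto simp: der_coeff_def)
    ultimately show ?thesis
      by simp
  qed
qed

lemma leads_der:
  assumes "leads w c f"
  shows "leads (shift w) (c * der_coeff lam (size w)) (der lam f)"
proof -
  have "leads (shift w) (if u = w then c * der_coeff lam (size w) else 0)
      (cst (Poly_Mapping.lookup f u) * der_word lam (sorted_list_of_multiset u))"
    if "u \<in> Poly_Mapping.keys f" for u
  proof -
    have u: "leads (shift u) (Poly_Mapping.lookup f u * der_coeff lam (size u))
        (cst (Poly_Mapping.lookup f u) * der_word lam (sorted_list_of_multiset u))"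
      using leads_cst_mult[OF leads_der_word[of "sorted_list_of_multiset u"]]
      by (metis mset_sorted_list_of_multiset size_mset)
    show ?thesis
    proof (cases "u = w")
      case True
      then show ?thesis
        using u assms by (simp add: leads_def)
    next
      case False
      then have "shift u \<prec> shift w"
        using assms that by (auto simp: leads_def deglex_eq_def intro: shift_less)
      then show ?thesis
        using leads_weaken[OF u] False by simp
    qed
  qed
  then have "leads (shift w) (\<Sum>u\<in>Poly_Mapping.keys f. if u = w then c * der_coeff lam (size w) else 0)
      (der lam f)"
    unfolding der_def by (rule leads_sum)
  moreover have "w \<notin> Poly_Mapping.keys f \<Longrightarrow> c = 0"
    using assms by (simp add: leads_def in_keys_iff)
  ultimately show ?thesis
    by (cases "w \<in> Poly_Mapping.keys f") simp_all
qed

lemma leads_der_pow: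
  assumes "leads w c f"
  shows "leads ((shift ^^ i) w) (c * der_coeff lam (size w) ^ i) ((der lam ^^ i) f)"
proof (induction i)
  case (Suc i)
  then show ?case
    using leads_der[OF Suc, of lam] by (simp add: ac_simps)
qed (use assms in simp)

section \<open>Sums with leading monomials below a bound\<close>

lemma sum_below_0 [simp]: "sum_below Y P w 0"
  unfolding sum_below_def by (intro exI[of _ 0]) auto

lemma sum_below_add_term:
  assumes "sum_below Y P w h" "p \<in> P" "p \<noteq> 0" "u \<in> mons Y" "lm p + u \<prec> w"
  shows "sum_below Y P w (h + cst c * p * mon u)"
proof -
  obtain n c' p' u' where *: "\<forall>r<n. p' r \<in> P \<and> p' r \<noteq> 0 \<and> u' r \<in> mons Y \<and> lm (p' r) + u' r \<prec> w"
    and h: "h = (\<Sum>r<(n::nat). cst (c' r) * p' r * mon (u' r))"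
    using assms(1) by (auto simp: sum_below_def)
  show ?thesis
    unfolding sum_below_def
    by (intro exI[of _ "Suc n"] exI[of _ "c'(n := c)"] exI[of _ "p'(n := p)"] exI[of _ "u'(n := u)"])
       (use * assms in \<open>auto simp: h less_Suc_eq\<close>)
qed

text \<open>With this rule and \<open>sum_below_add_term\<close>, the indexed sums behave like an
  inductively defined set, and the closure properties below avoid index manipulation.\<close>

lemma sum_below_induct [consumes 1, case_names zero add_term]:
  assumes "sum_below Y P w h"
    and zero: "Q 0"
    and add_term: "\<And>h c p u. sum_below Y P w h \<Longrightarrow> Q h \<Longrightarrow> p \<in> P \<Longrightarrow> p \<noteq> 0 \<Longrightarrow> u \<in> mons Y \<Longrightarrow>
      lm p + u \<prec> w \<Longrightarrow> Q (h + cst c * p * mon u)"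
  shows "Q h"
proof -
  obtain n c p u where *: "\<forall>r<n. p r \<in> P \<and> p r \<noteq> 0 \<and> u r \<in> mons Y \<and> lm (p r) + u r \<prec> w"
    and h: "h = (\<Sum>r<(n::nat). cst (c r) * p r * mon (u r))"
    using assms(1) by (auto simp: sum_below_def)
  have "sum_below Y P w (\<Sum>r<m. cst (c r) * p r * mon (u r)) \<and> Q (\<Sum>r<m. cst (c r) * p r * mon (u r))"
    if "m \<le> n" for m
    using that
  proof (induction m)
    case (Suc m)
    then show ?case
      using * by (auto intro: add_term sum_below_add_term)
  qed (simp add: zero)
  then show ?thesis
    by (simp add: h)
qed

lemma sum_below_add:
  assumes "sum_below Y P w h" "sum_below Y P w h'"
  shows "sum_below Y P w (h + h')"
  using assms(2)
proof (induction rule: sum_below_induct)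
  case (add_term h' c p u)
  then show ?case
    using sum_below_add_term[of Y P w "h + h'" p u c] by (simp add: add.assoc)
qed (use assms(1) in simp)

lemma sum_below_sum: "(\<And>i. i \<in> A \<Longrightarrow> sum_below Y P w (f i)) \<Longrightarrow> sum_below Y P w (sum f A)"
  by (induction A rule: infinite_finite_induct) (auto intro: sum_below_add)

lemma sum_below_cst_mult:
  assumes "sum_below Y P w h"
  shows "sum_below Y P w (cst c * h)"
  using assms
proof (induction rule: sum_below_induct)
  case (add_term h c' p u)
  then show ?case
    using sum_below_add_term[of Y P w "cst c * h" p u "c * c'"]
    by (simp add: distrib_left mult_cst_cst mult.assoc)
qed simp

lemma sum_below_uminus: "sum_below Y P w h \<Longrightarrow> sum_below Y P w (- h)"
  using sum_below_cst_mult[of Y P w h "- 1"] by (simp add: single_uminus)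

lemma sum_below_diff: "sum_below Y P w h \<Longrightarrow> sum_below Y P w h' \<Longrightarrow> sum_below Y P w (h - h')"
  using sum_below_add[OF _ sum_below_uminus, of Y P w h h'] by simp

lemma sum_below_mult_mon:
  assumes "sum_below Y P w h" "m \<in> mons Y"
  shows "sum_below Y P (w + m) (h * mon m)"
  using assms(1)
proof (induction rule: sum_below_induct)
  case (add_term h c p u)
  have "lm p + (u + m) \<prec> w + m"
    using add_term by (simp flip: add.assoc)
  moreover have "u + m \<in> mons Y"
    using add_term assms(2) by (auto simp: mons_def)
  moreover have "(h + cst c * p * mon u) * mon m = h * mon m + cst c * p * mon (u + m)"
    by (simp add: distrib_right mult.assoc mult_single)
  ultimately show ?case
    using add_term by (auto intro: sum_below_add_term)
qed simp

text \<open>Expanding \<open>g\<close> into monomials gives the required sum. The bound is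
  conditional on \<open>p \<noteq> 0\<close> because a derivative may vanish, and \<open>lm\<close>
  is meaningful only for nonzero polynomials.\<close>

lemma sum_below_mult:
  assumes "p \<in> P" "Poly_Mapping.keys g \<subseteq> mons Y"
    and less: "\<And>v. p \<noteq> 0 \<Longrightarrow> v \<in> Poly_Mapping.keys g \<Longrightarrow> lm p + v \<prec> w"
  shows "sum_below Y P w (p * g)"
proof (cases "p = 0")
  case False
  have "sum_below Y P w (\<Sum>v\<in>Poly_Mapping.keys g. 0 + cst (Poly_Mapping.lookup g v) * p * mon v)"
    using assms False by (intro sum_below_sum sum_below_add_term) auto
  also have "(\<Sum>v\<in>Poly_Mapping.keys g. 0 + cst (Poly_Mapping.lookup g v) * p * mon v) =
      p * (\<Sum>v\<in>Poly_Mapping.keys g. cst (Poly_Mapping.lookup g v) * mon v)"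
    by (simp add: sum_distrib_left ac_simps)
  finally show ?thesis
    by (simp only: mpoly_as_sum[symmetric])
qed simp


section \<open>The differential Groebner-Shirshov basis\<close>

abbreviation derivatives ::
  "'k::comm_ring_1 \<Rightarrow> (nat \<times> 'x::linorder, 'k) mpoly set \<Rightarrow> (nat \<times> 'x, 'k) mpoly set" where
  "derivatives lam S \<equiv> {(der lam ^^ k) s | k s. s \<in> S}"

lemma der_in_derivatives: "p \<in> derivatives lam S \<Longrightarrow> der lam p \<in> derivatives lam S"
  by (force intro: exI[of _ "Suc _"])

lemma der_one [simp]: "der lam 1 = 0"
  using der_single[of lam "{#}" 1] by simp

lemma der_diff: "der lam (p - q) = der lam p - der lam q"
  using der_add[of lam "p - q" q] by simp

lemma der_pow_diff: "(der lam ^^ i) (p - q) = (der lam ^^ i) p - (der lam ^^ i) q"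
  by (induction i) (simp_all add: der_diff)

lemma lm_der_le:
  assumes "der lam p \<noteq> 0"
  shows "lm (der lam p) \<preceq> shift (lm p)"
proof -
  have "p \<noteq> 0"
    using assms by auto
  then show ?thesis
    using leads_der[OF leads_lm(1), of p lam] lm_in_keys[OF assms] by (simp add: leads_def)
qed

lemma keys_der_mon_le: "v \<in> Poly_Mapping.keys (der lam (mon u)) \<Longrightarrow> v \<preceq> shift u"
  using leads_der[OF leads_single, of u 1 lam] by (simp add: leads_def)

lemma leads_0_less: "leads w 0 f \<Longrightarrow> v \<in> Poly_Mapping.keys f \<Longrightarrow> v \<prec> w"
  by (auto simp: leads_def deglex_eq_def in_keys_iff)

lemma keys_der_mon: "u \<in> mons (Delta Xs) \<Longrightarrow> Poly_Mapping.keys (der lam (mon u)) \<subseteq> mons (Delta Xs)"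
  by (intro keys_der) auto

text \<open>The Leibniz rule turns a term into multiples of \<open>p\<close> and
  \<open>der lam p\<close>, both of which are derivatives of elements of \<open>S\<close>. No letter
  is raised more than once, so all monomials stay at or below \<open>shift (lm p + u)\<close>, which
  is strictly below \<open>shift w\<close>.\<close>

lemma sum_below_der:
  assumes "sum_below (Delta Xs) (derivatives lam S) w h"
  shows "sum_below (Delta Xs) (derivatives lam S) (shift w) (der lam h)"
  using assms
proof (induction rule: sum_below_induct)
  case (add_term h c p u)
  let ?sb = "sum_below (Delta Xs) (derivatives lam S) (shift w)"
  have shift: "shift (lm p) + shift u \<prec> shift w"
    using shift_less[OF add_term.hyps(5)] by simp
  have bound: "x + y \<prec> shift w" if "x \<preceq> shift (lm p)" "y \<preceq> shift u" for x y
    using deglex_add_mono[OF that] shift by (rule deglex.le_less_trans)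
  have dp: "der lam p \<in> derivatives lam S"
    using add_term.hyps(2) by (rule der_in_derivatives)
  have "?sb (der lam p * mon u)"
    by (rule sum_below_mult[OF dp]) (use add_term.hyps(4) in \<open>auto intro!: bound lm_der_le le_shift\<close>)
  moreover have "?sb (p * der lam (mon u))"
    by (rule sum_below_mult[OF add_term.hyps(2) keys_der_mon])
       (use add_term.hyps(4) in \<open>auto intro: bound le_shift keys_der_mon_le\<close>)
  moreover have "?sb (der lam p * der lam (mon u))"
    by (rule sum_below_mult[OF dp keys_der_mon])
       (use add_term.hyps(4) in \<open>auto intro: bound lm_der_le keys_der_mon_le\<close>)
  moreover have "der lam (h + cst c * p * mon u) = der lam h + cst c * (der lam p * mon u +
      p * der lam (mon u) + cst lam * (der lam p * der lam (mon u)))"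
    unfolding mult.assoc der_add der_cst_mult by (simp only: der_mult)
  ultimately show ?case
    using add_term.IH by (auto intro!: sum_below_add sum_below_cst_mult)
qed simp

lemma sum_below_der_pow:
  assumes "sum_below (Delta Xs) (derivatives lam S) w h"
  shows "sum_below (Delta Xs) (derivatives lam S) ((shift ^^ i) w) ((der lam ^^ i) h)"
  using assms by (induction i) (simp_all add: sum_below_der)

section \<open>Leading terms of iterated derivatives and of their multiples\<close>

lemma lm_der_pow:
  fixes f :: "(nat \<times> 'x::linorder, 'k::field) mpoly"
  assumes "lam \<noteq> 0" "(der lam ^^ i) f \<noteq> 0"
  shows "lm ((der lam ^^ i) f) = (shift ^^ i) (lm f)"
    and "lc ((der lam ^^ i) f) = lc f * lam ^ ((size (lm f) - 1) * i)"
proof -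
  have "f \<noteq> 0"
  proof
    assume "f = 0"
    moreover have "(der lam ^^ i) (0 :: (nat \<times> 'x, 'k) mpoly) = 0"
      by (induction i) simp_all
    ultimately show False
      using assms(2) by simp
  qed
  then have *: "leads ((shift ^^ i) (lm f)) (lc f * der_coeff lam (size (lm f)) ^ i) ((der lam ^^ i) f)"
    and "lc f \<noteq> 0"
    by (auto intro: leads_der_pow leads_lm dest: leads_lm(2))
  have coeff: "der_coeff lam (size (lm f)) ^ i = lam ^ ((size (lm f) - 1) * i)"
  \<comment> \<open>Only here could the truncated exponent \<open>size (lm f) - 1\<close> be wrong.
    A polynomial with empty leading monomial is constant, so a nonzero derivative excludes
    \<open>i \<noteq> 0\<close>; for \<open>i = 0\<close> both powers are 1.\<close>
  proof (cases "lm f = {#} \<and> i \<noteq> 0")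
    case True
    then have "leads {#} 0 ((der lam ^^ i) f)"
      using * by (simp add: der_coeff_def zero_power)
    then have "lm ((der lam ^^ i) f) \<prec> {#}"
      using lm_in_keys[OF assms(2)] by (rule leads_0_less)
    then show ?thesis
      by (simp add: deglex_iff count_less_def)
  next
    case False
    then show ?thesis
      by (auto simp: der_coeff_def power_mult)
  qed
  have "lc f * der_coeff lam (size (lm f)) ^ i \<noteq> 0"
    using \<open>lc f \<noteq> 0\<close> assms(1) by (simp add: coeff)
  with * show "lm ((der lam ^^ i) f) = (shift ^^ i) (lm f)"
    and "lc ((der lam ^^ i) f) = lc f * lam ^ ((size (lm f) - 1) * i)"
    by (auto simp: coeff dest: lm_eqI lc_eqI)
qed

lemma der_pow_nonzero:
  fixes f :: "(nat \<times> 'x::linorder, 'k::field) mpoly"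
  assumes "lam \<noteq> 0" "f \<noteq> 0" "lm f \<noteq> {#}"
  shows "(der lam ^^ i) f \<noteq> 0"
  using leads_nonzero[OF leads_der_pow[OF leads_lm(1)[OF assms(2)]], of lam i] assms leads_lm(2)[of f]
  by (simp add: der_coeff_def)

text \<open>In \<open>der lam (q * mon b)\<close> the two unweighted summands leave a nonempty
  factor unraised and are therefore small. The weighted one differs from the claimed main term by
  \<open>der lam q * ?g\<close>.\<close>

lemma sum_below_der_mult_mon:
  fixes q :: "(nat \<times> 'x::linorder, 'k::field) mpoly"
  assumes "q \<in> derivatives lam S" "q \<noteq> 0" "lm q \<noteq> {#}" "b \<in> mons (Delta Xs)"
  shows "sum_below (Delta Xs) (derivatives lam S) (shift (lm q + b))
    (der lam (q * mon b) - cst (lam ^ size b) * (der lam q * mon (shift b)))"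
proof (cases "b = {#}")
  case True
  then show ?thesis
    using True by simp
next
  case False
  let ?sb = "sum_below (Delta Xs) (derivatives lam S) (shift (lm q + b))"
  \<comment> \<open>The coefficient of \<open>shift b\<close> in
    \<open>cst lam * der lam (mon b)\<close> is \<open>lam * lam ^ (size b - 1)\<close>, so the head
    cancels and all monomials of \<open>?g\<close> are strictly below
    \<open>shift b\<close>.\<close>
  let ?g = "cst lam * der lam (mon b) - cst (lam ^ size b) * mon (shift b)"
  have dq: "der lam q \<in> derivatives lam S"
    using assms(1) by (rule der_in_derivatives)
  have shift_b: "shift b \<in> mons (Delta Xs)"
    using shift_pow_mons[OF assms(4), of 1] by simp
  have "leads (shift b) (lam * (1 * der_coeff lam (size b)) + - (lam ^ size b * 1))
      (cst lam * der lam (mon b) + cst (- (lam ^ size b)) * mon (shift b))"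
    using leads_cst_mult[OF leads_single[of "shift b" 1], of "- (lam ^ size b)"]
    by (intro leads_add leads_cst_mult leads_der leads_single) auto
  moreover have "lam * der_coeff lam (size b) = lam ^ size b"
    using False by (cases b) (auto simp: der_coeff_def)
  ultimately have g: "leads (shift b) 0 ?g"
    by (simp add: single_uminus)
  have keys_g: "Poly_Mapping.keys ?g \<subseteq> mons (Delta Xs)"
    unfolding diff_conv_add_uminus
    by (intro keys_add_closed keys_mult_closed keys_der_mon assms(4))
       (use shift_b keys_mult_closed[of "cst (lam ^ size b)" "Delta Xs" "mon (shift b)"] in
         \<open>auto simp: mons_def simp del: keys_mult\<close>)
  have "?sb (der lam q * mon b)"
    by (rule sum_below_mult[OF dq])
       (use assms(4) less_shift[OF False] lm_der_le[of lam q] in \<open>auto intro: deglex_add_le_less\<close>)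
  moreover have "?sb (q * der lam (mon b))"
    by (rule sum_below_mult[OF assms(1) keys_der_mon])
       (use assms(4) less_shift[OF assms(3)] keys_der_mon_le in \<open>auto intro: deglex_add_less_le\<close>)
  moreover have "?sb (der lam q * ?g)"
    by (rule sum_below_mult[OF dq keys_g])
       (use lm_der_le[of lam q] leads_0_less[OF g] in \<open>auto intro: deglex_add_le_less\<close>)
  moreover have "der lam (q * mon b) - cst (lam ^ size b) * (der lam q * mon (shift b)) =
      der lam q * mon b + q * der lam (mon b) + der lam q * ?g"
    unfolding der_mult by (simp only: algebra_simps)
  ultimately show ?thesis
    by (simp only: sum_below_add)
qed

text \<open>Each derivation contributes a factor \<open>lam ^ size a\<close>, since raising letters
  preserves the size. The new error is the derivative of the old one plus a multiple of the one-step
  error for \<open>?q\<close> and \<open>?b\<close>.\<close>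

lemma sum_below_der_pow_mult_mon:
  fixes p :: "(nat \<times> 'x::linorder, 'k::field) mpoly"
  assumes "lam \<noteq> 0" "p \<in> S" "p \<noteq> 0" "lm p \<noteq> {#}" "a \<in> mons (Delta Xs)"
  shows "sum_below (Delta Xs) (derivatives lam S) ((shift ^^ i) (lm p + a))
    ((der lam ^^ i) (p * mon a) - cst (lam ^ (size a * i)) * ((der lam ^^ i) p * mon ((shift ^^ i) a)))"
proof (induction i)
  case (Suc i)
  let ?sb = "sum_below (Delta Xs) (derivatives lam S) ((shift ^^ Suc i) (lm p + a))"
  let ?q = "(der lam ^^ i) p" and ?b = "(shift ^^ i) a" and ?c = "cst (lam ^ (size a * i))"
  have q: "?q \<noteq> 0"
    using assms by (intro der_pow_nonzero)
  have lm_q: "lm ?q = (shift ^^ i) (lm p)"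
    using assms(1) q by (rule lm_der_pow)
  have "?q \<in> derivatives lam S"
    using assms(2) by blast
  then have "sum_below (Delta Xs) (derivatives lam S) (shift (lm ?q + ?b))
      (der lam (?q * mon ?b) - cst (lam ^ size ?b) * (der lam ?q * mon (shift ?b)))"
    using q assms by (intro sum_below_der_mult_mon shift_pow_mons) (simp_all add: lm_q)
  then have "?sb (der lam (?q * mon ?b) - cst (lam ^ size a) * (der lam ?q * mon (shift ?b)))"
    by (simp add: lm_q shift_pow_add)
  moreover have "?sb (der lam ((der lam ^^ i) (p * mon a) - ?c * (?q * mon ?b)))"
    using sum_below_der[OF Suc] by simp
  moreover have "(der lam ^^ Suc i) (p * mon a) -
      cst (lam ^ (size a * Suc i)) * ((der lam ^^ Suc i) p * mon ((shift ^^ Suc i) a)) =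
      der lam ((der lam ^^ i) (p * mon a) - ?c * (?q * mon ?b)) +
      ?c * (der lam (?q * mon ?b) - cst (lam ^ size a) * (der lam ?q * mon (shift ?b)))"
  proof -
    have "cst (lam ^ (size a * Suc i)) = (?c * cst (lam ^ size a) :: (nat \<times> 'x, 'k) mpoly)"
      by (simp add: mult_single power_add mult.commute)
    then show ?thesis
      unfolding funpow.simps comp_apply der_diff der_cst_mult by (simp only: algebra_simps)
  qed
  ultimately show ?case
    by (simp only: sum_below_add sum_below_cst_mult)
qed simp

section \<open>Lifting compositions from k[X] to k[Delta(X)]\<close>

lemma sum_below_i_hat:
  assumes "sum_below Xs S w h" "0 \<notin> S"
  shows "sum_below (Delta Xs) (derivatives lam (i_hat ` S)) (image_mset (Pair 0) w) (i_hat h)"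
  using assms(1)
proof (induction rule: sum_below_induct)
  case (add_term h c p u)
  have lead: "leads (image_mset (Pair 0) (lm p)) (lc p) (i_hat p)" and "lc p \<noteq> 0"
    using add_term.hyps by (auto intro: leads_i_hat leads_lm dest: leads_lm(2))
  then have "i_hat p \<noteq> 0" and lm: "lm (i_hat p) = image_mset (Pair 0) (lm p)"
    by (rule leads_nonzero, rule lm_eqI)
  moreover have "i_hat p \<in> derivatives lam (i_hat ` S)"
    using add_term.hyps(2) by (force intro: exI[of _ 0])
  moreover have "lm (i_hat p) + image_mset (Pair 0) u \<prec> image_mset (Pair 0) w"
    using deglex_image_mset[OF strict_mono_Pair add_term.hyps(5)] by (simp add: lm)
  ultimately show ?case
    using sum_below_add_term[OF add_term.IH _ _ image_mset_Pair_mons[OF add_term.hyps(4)]]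
    by (simp add: i_hat_add i_hat_mult)
qed simp

text \<open>For distinct orders the two factors share no letter, so their product divides
  \<open>w\<close>, against the size bound. For equal orders the least common multiple
  \<open>s \<union># t\<close>, placed at that order, divides \<open>w\<close>.\<close>

lemma image_mset_Pair_overlap:
  fixes s t :: "'x::linorder multiset" and i j :: nat
  assumes w: "w = image_mset (Pair i) s + u" "w = image_mset (Pair j) t + v"
    and size: "size w < size s + size t"
  shows "i = j" and "image_mset (Pair i) (s \<union># t) \<subseteq># w"
proof -
  have count_Pair: "count (image_mset (Pair k) m) (l, x) = (if l = k then count m x else 0)"
    for k l :: nat and m :: "'x multiset" and x
  proof (cases "l = k")
    case True
    then show ?thesis
      using count_image_mset_strict_mono[OF strict_mono_Pair, of k m x] by simp
  qed (auto simp: count_eq_zero_iff)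
  have count_le: "count (image_mset (Pair i) s) y \<le> count w y" "count (image_mset (Pair j) t) y \<le> count w y" for y
    using w by (metis count_union le_add1)+
  show "i = j"
  proof (rule ccontr)
    assume "i \<noteq> j"
    have "image_mset (Pair i) s + image_mset (Pair j) t \<subseteq># w"
    proof (rule mset_subset_eqI)
      fix y :: "nat \<times> 'x"
      show "count (image_mset (Pair i) s + image_mset (Pair j) t) y \<le> count w y"
        using count_le[of y] \<open>i \<noteq> j\<close> by (cases y) (auto simp: count_Pair)
    qed
    then show False
      using size_mset_mono size by fastforce
  qed
  show "image_mset (Pair i) (s \<union># t) \<subseteq># w"
  proof (rule mset_subset_eqI)
    fix y :: "nat \<times> 'x"
    show "count (image_mset (Pair i) (s \<union># t)) y \<le> count w y"
      using count_le[of y] \<open>i = j\<close> by (cases y) (auto simp: count_Pair)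
  qed
qed

theorem diff_gs_basis_i_hat:
  fixes lam :: "'k::field" and Xs :: "'x::linorder set"
  assumes "lam \<noteq> 0" and gs: "gs_basis Xs S"
  shows "diff_gs_basis lam Xs (i_hat ` S)"
proof -
  let ?P = "image_mset (Pair (0 :: nat)) :: 'x multiset \<Rightarrow> _"
  let ?sb = "sum_below (Delta Xs) (derivatives lam (i_hat ` S))"
  let ?d = "\<lambda>i. der lam ^^ i"
  have S: "Poly_Mapping.keys s \<subseteq> mons Xs" "s \<noteq> 0" "lc s = 1" if "s \<in> S" for s
    using gs that by (auto simp: gs_basis_def monic_def)
  have lead: "leads (?P (lm s)) 1 (i_hat s)" if "s \<in> S" for s
    using leads_i_hat[OF leads_lm(1)[OF S(2)[OF that]]] S(3)[OF that] by simp
  have lm_i_hat: "lm (i_hat s) = ?P (lm s)" and i_hat_monic: "i_hat s \<noteq> 0" "lc (i_hat s) = 1"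
    if "s \<in> S" for s
    using lead[OF that] by (auto intro: lm_eqI lc_eqI dest: leads_nonzero)
  have lm_d: "lm (?d i (i_hat s)) = image_mset (Pair i) (lm s)"
    if "s \<in> S" "?d i (i_hat s) \<noteq> 0" for s i
    using lm_der_pow(1)[OF assms(1) that(2)] by (simp add: lm_i_hat that(1) shift_pow_Pair)
  have normalized_d: "normalized (?d i (i_hat s)) = cst (inverse (lam ^ ((size (lm s) - 1) * i))) * ?d i (i_hat s)"
    if "s \<in> S" "?d i (i_hat s) \<noteq> 0" for s i
    using lm_der_pow(2)[OF assms(1) that(2)] i_hat_monic(2)[OF that(1)]
    by (simp add: normalized_def lm_i_hat that(1))
  have composition: "?sb w (normalized (?d i (i_hat f)) * mon u - normalized (?d j (i_hat g)) * mon v)"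
    if "f \<in> S" "g \<in> S" and uv: "u \<in> mons (Delta Xs)" "v \<in> mons (Delta Xs)"
      and nz: "?d i (i_hat f) \<noteq> 0" "?d j (i_hat g) \<noteq> 0"
      and w: "w = lm (?d i (i_hat f)) + u" "w = lm (?d j (i_hat g)) + v"
      and size: "size w < size (lm (i_hat f)) + size (lm (i_hat g))"
    for f g i j u v w
  proof -
    have w': "w = image_mset (Pair i) (lm f) + u" "w = image_mset (Pair j) (lm g) + v"
      using w that lm_d by metis+
    have size': "size w < size (lm f) + size (lm g)"
      using size that by (simp add: lm_i_hat)
    have "i = j"
      using w' size' by (rule image_mset_Pair_overlap)
    \<comment> \<open>If one leading monomial were empty, the other alone would have to be larger
      than \<open>w\<close>, which it divides.\<close>
    have ne: "lm f \<noteq> {#}" "lm g \<noteq> {#}"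
      using size' w' by auto
    \<comment> \<open>The composition to be lifted lives over the least common multiple
      \<open>w0\<close>; the cofactors \<open>a\<close> and \<open>b\<close> involve letters of X
      only, while \<open>r\<close> collects whatever else \<open>w\<close> contains.\<close>
    define w0 a b r where "w0 = lm f \<union># lm g" and "a = w0 - lm f" and "b = w0 - lm g"
      and "r = w - image_mset (Pair i) w0"
    have a: "w0 = lm f + a" and b: "w0 = lm g + b"
      by (simp_all add: w0_def a_def b_def)
    have r: "w = image_mset (Pair i) w0 + r"
      using image_mset_Pair_overlap(2)[OF w' size'] by (simp add: w0_def r_def)
    have u: "u = image_mset (Pair i) a + r"
      using w'(1) r by (simp add: a)
    have v: "v = image_mset (Pair i) b + r"
      using w'(2) r \<open>i = j\<close> by (simp add: b)
    have ab: "a \<in> mons Xs" "b \<in> mons Xs" and r_mons: "r \<in> mons (Delta Xs)"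
      using uv by (auto simp: u v mons_def Delta_def)
    have "size w0 \<le> size w"
      by (simp add: r)
    then have "size w0 < size (lm f) + size (lm g)"
      using size' by simp
    then have "sum_below Xs S w0 (f * mon a - g * mon b)"
      using gs that(1,2) ab a b unfolding gs_basis_def by blast
    then have "?sb (?P w0) (i_hat f * mon (?P a) - i_hat g * mon (?P b))"
      using sum_below_i_hat[of Xs S w0 _ lam] S(2) by (fastforce simp: i_hat_diff i_hat_mult)
    from sum_below_der_pow[OF this, of i]
    have 0: "?sb (image_mset (Pair i) w0) (?d i (i_hat f * mon (?P a)) - ?d i (i_hat g * mon (?P b)))"
      by (simp add: shift_pow_Pair der_pow_diff)
    have 1: "?sb (image_mset (Pair i) w0) (?d i (i_hat s * mon (?P c)) -
        cst (lam ^ (size c * i)) * (?d i (i_hat s) * mon (image_mset (Pair i) c)))"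
      if "s \<in> S" "lm s \<noteq> {#}" "c \<in> mons Xs" "w0 = lm s + c" for s c
      using sum_below_der_pow_mult_mon[OF assms(1), of "i_hat s" "i_hat ` S" "?P c" Xs i] that
      by (simp add: lm_i_hat i_hat_monic image_mset_Pair_mons shift_pow_Pair flip: image_mset_union)
    let ?T = "\<lambda>s c. cst (lam ^ (size c * i)) * (?d i (i_hat s) * mon (image_mset (Pair i) c))"
    \<comment> \<open>Subtracting the error for \<open>f\<close> and adding that for
      \<open>g\<close> cancels the derivatives of the full products and leaves the two main
      terms.\<close>
    have 2: "?sb (image_mset (Pair i) w0) (?T f a - ?T g b)"
      using sum_below_add[OF sum_below_diff[OF 0 1[OF that(1) ne(1) ab(1) a]] 1[OF that(2) ne(2) ab(2) b]]
      by simp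
    have 3: "cst (inverse (lam ^ ((size w0 - 1) * i))) * ?T s c =
        normalized (?d i (i_hat s)) * mon (image_mset (Pair i) c)"
      if "s \<in> S" "lm s \<noteq> {#}" "w0 = lm s + c" "?d i (i_hat s) \<noteq> 0" for s c
    proof -
      \<comment> \<open>both scalars agree because \<open>|w0| = |lm s| + |c|\<close>; \<open>lm s \<noteq> {#}\<close> excludes truncation in \<open>|lm s| - 1\<close>\<close>
      have "(size w0 - 1) * i = (size (lm s) - 1) * i + size c * i"
        using that(2,3) by (cases "lm s") (auto simp: algebra_simps)
      then have "inverse (lam ^ ((size w0 - 1) * i)) * lam ^ (size c * i) =
          inverse (lam ^ ((size (lm s) - 1) * i))"
        using assms(1) by (simp add: power_add)
      then show ?thesis
        unfolding normalized_d[OF that(1,4)] by (simp add: mult.assoc flip: mult_cst_cst)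
    qed
    have 4: "cst (inverse (lam ^ ((size w0 - 1) * i))) * (?T f a - ?T g b) =
        normalized (?d i (i_hat f)) * mon (image_mset (Pair i) a) -
        normalized (?d i (i_hat g)) * mon (image_mset (Pair i) b)"
      unfolding right_diff_distrib
      using 3[OF that(1) ne(1) a nz(1)] 3[OF that(2) ne(2) b] nz(2) \<open>i = j\<close> by metis
    have "?sb (image_mset (Pair i) w0) (normalized (?d i (i_hat f)) * mon (image_mset (Pair i) a) -
        normalized (?d i (i_hat g)) * mon (image_mset (Pair i) b))"
      using sum_below_cst_mult[OF 2, of "inverse (lam ^ ((size w0 - 1) * i))"] unfolding 4 .
    from sum_below_mult_mon[OF this r_mons] show ?thesis
      by (simp add: r u v \<open>i = j\<close> left_diff_distrib mult.assoc mult_single)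
  qed
  show ?thesis
    unfolding diff_gs_basis_def
  proof (intro conjI ballI allI impI)
    show "i_hat ` S \<subseteq> carrier (poly_alg (Delta Xs))"
      using i_hat_closed[OF S(1)] by auto
    show "monic f" if "f \<in> i_hat ` S" for f :: "(nat \<times> 'x, 'k) mpoly"
      using that i_hat_monic by (auto simp: monic_def)
  qed (use composition in blast)
qed

section \<open>Quotient algebras\<close>

abbreviation kalgebra :: "('k::field, 'a) module \<Rightarrow> bool" where
  "kalgebra A \<equiv> algebra (ring_of_type_algebra :: 'k ring) A"

lemma carrier_ring_of_type_algebra [simp]: "carrier ring_of_type_algebra = UNIV"
  by (simp add: ring_of_type_algebra_def)

lemma alg_quot_simps:
  "carrier (alg_quot A J) = carrier (A Quot J)"
  "x \<otimes>\<^bsub>alg_quot A J\<^esub> y = x \<otimes>\<^bsub>A Quot J\<^esub> y"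
  "\<one>\<^bsub>alg_quot A J\<^esub> = \<one>\<^bsub>A Quot J\<^esub>"
  "\<zero>\<^bsub>alg_quot A J\<^esub> = \<zero>\<^bsub>A Quot J\<^esub>"
  "x \<oplus>\<^bsub>alg_quot A J\<^esub> y = x \<oplus>\<^bsub>A Quot J\<^esub> y"
  "c \<odot>\<^bsub>alg_quot A J\<^esub> x = coset_map A J (\<lambda>x. c \<odot>\<^bsub>A\<^esub> x) x"
  by (simp_all add: alg_quot_def ring.defs module.defs)

lemma alg_homI:
  assumes "\<And>x. x \<in> carrier A \<Longrightarrow> h x \<in> carrier B"
    and "\<And>x y. x \<in> carrier A \<Longrightarrow> y \<in> carrier A \<Longrightarrow> h (x \<otimes>\<^bsub>A\<^esub> y) = h x \<otimes>\<^bsub>B\<^esub> h y"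
    and "\<And>x y. x \<in> carrier A \<Longrightarrow> y \<in> carrier A \<Longrightarrow> h (x \<oplus>\<^bsub>A\<^esub> y) = h x \<oplus>\<^bsub>B\<^esub> h y"
    and "h \<one>\<^bsub>A\<^esub> = \<one>\<^bsub>B\<^esub>"
    and "\<And>c x. x \<in> carrier A \<Longrightarrow> h (c \<odot>\<^bsub>A\<^esub> x) = c \<odot>\<^bsub>B\<^esub> h x"
  shows "h \<in> alg_hom A B"
  using assms by (auto simp: alg_hom_def ring_hom_def)

lemma alg_homD:
  assumes "h \<in> alg_hom A B"
  shows "x \<in> carrier A \<Longrightarrow> h x \<in> carrier B"
    and "x \<in> carrier A \<Longrightarrow> y \<in> carrier A \<Longrightarrow> h (x \<otimes>\<^bsub>A\<^esub> y) = h x \<otimes>\<^bsub>B\<^esub> h y"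
    and "x \<in> carrier A \<Longrightarrow> y \<in> carrier A \<Longrightarrow> h (x \<oplus>\<^bsub>A\<^esub> y) = h x \<oplus>\<^bsub>B\<^esub> h y"
    and "h \<one>\<^bsub>A\<^esub> = \<one>\<^bsub>B\<^esub>"
    and "x \<in> carrier A \<Longrightarrow> h (c \<odot>\<^bsub>A\<^esub> x) = c \<odot>\<^bsub>B\<^esub> h x"
  using assms by (auto simp: alg_hom_def ring_hom_def)

text \<open>Preservation of zero is not part of \<open>alg_hom\<close>; it is recovered from
  compatibility with the scalar 0.\<close>

lemma alg_hom_zero:
  assumes "kalgebra A" "kalgebra B" "h \<in> alg_hom A B"
  shows "h \<zero>\<^bsub>A\<^esub> = \<zero>\<^bsub>B\<^esub>"
proof -
  interpret A: algebra "ring_of_type_algebra :: 'a ring" A by fact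
  interpret B: algebra "ring_of_type_algebra :: 'a ring" B by fact
  have "h \<zero>\<^bsub>A\<^esub> = (0 :: 'a) \<odot>\<^bsub>B\<^esub> h \<zero>\<^bsub>A\<^esub>"
    using alg_homD(5)[OF assms(3), of "\<zero>\<^bsub>A\<^esub>" 0] A.smult_r_null by simp
  then show ?thesis
    using alg_homD(1)[OF assms(3), of "\<zero>\<^bsub>A\<^esub>"] B.smult_l_null by (simp add: ring_of_type_algebra_def)
qed

lemma alg_hom_comp:
  "h \<in> alg_hom A B \<Longrightarrow> g \<in> alg_hom B C \<Longrightarrow> (\<lambda>x. g (h x)) \<in> alg_hom A C"
  by (rule alg_homI) (simp_all add: alg_homD)

lemma ideal_kernel_alg_hom:
  assumes "kalgebra A" "kalgebra B" "h \<in> alg_hom A B"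
  shows "ideal {x \<in> carrier A. h x = \<zero>\<^bsub>B\<^esub>} A"
proof -
  interpret A: algebra "ring_of_type_algebra :: 'a ring" A by fact
  interpret B: algebra "ring_of_type_algebra :: 'a ring" B by fact
  interpret ring_hom_ring A B h
    using assms(3) by (intro ring_hom_ringI2 A.ring_axioms B.ring_axioms) (simp add: alg_hom_def)
  show ?thesis
    using kernel_is_ideal unfolding a_kernel_def' .
qed

text \<open>Equational axioms pass to surjective images, so quotients become algebras without coset
  arithmetic. Preservation of zero is assumed because \<open>B\<close> is not yet known to be a
  ring.\<close>

lemma kalgebra_surj_image:
  assumes "kalgebra A" and hom: "h \<in> alg_hom A B" and zero: "h \<zero>\<^bsub>A\<^esub> = \<zero>\<^bsub>B\<^esub>"
    and surj: "carrier B = h ` carrier A"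
  shows "kalgebra B"
proof -
  interpret A: algebra "ring_of_type_algebra :: 'a ring" A by fact
  note ops = alg_homD(2-5)[OF hom, symmetric] zero[symmetric]
  have "cring B"
  proof (intro cringI abelian_groupI comm_monoidI)
    show "\<exists>y\<in>carrier B. y \<oplus>\<^bsub>B\<^esub> x = \<zero>\<^bsub>B\<^esub>" if x: "x \<in> carrier B" for x
    proof -
      obtain x' where x': "x' \<in> carrier A" "x = h x'"
        using x surj by auto
      then have "h (\<ominus>\<^bsub>A\<^esub> x') \<oplus>\<^bsub>B\<^esub> x = \<zero>\<^bsub>B\<^esub>"
        by (simp add: ops A.l_neg)
      then show ?thesis
        using x' surj by blast
    qed
  qed (auto simp: surj ops A.m_ac A.a_ac A.l_distr A.r_distr)
  then show ?thesis
    using cring_from_type_algebra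
    by (intro algebraI) (auto simp: surj ops A.smult_closed A.smult_l_distr A.smult_r_distr
      A.smult_assoc1 A.smult_assoc2 A.smult_one)
qed

section \<open>Maps induced on cosets\<close>

text \<open>All representatives contribute the same coset to the union, because they differ by
  elements that \<open>f\<close> sends into \<open>J'\<close>. This serves scalar multiplication,
  the operator and \<open>i_hat\<close> alike.\<close>

lemma coset_map_coset:
  assumes J: "ideal J A" and J': "ideal J' B"
    and closed: "\<And>x. x \<in> carrier A \<Longrightarrow> f x \<in> carrier B"
    and add: "\<And>x y. x \<in> carrier A \<Longrightarrow> y \<in> carrier A \<Longrightarrow> f (x \<oplus>\<^bsub>A\<^esub> y) = f x \<oplus>\<^bsub>B\<^esub> f y"
    and f_J: "f ` J \<subseteq> J'" and x: "x \<in> carrier A"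
  shows "coset_map B J' f (J +>\<^bsub>A\<^esub> x) = J' +>\<^bsub>B\<^esub> f x"
proof -
  interpret J: ideal J A by fact
  interpret J': ideal J' B by fact
  have "J' +>\<^bsub>B\<^esub> f y = J' +>\<^bsub>B\<^esub> f x" if y: "y \<in> J +>\<^bsub>A\<^esub> x" for y
  proof -
    obtain j where j: "j \<in> J" "y = j \<oplus>\<^bsub>A\<^esub> x"
      using y by (auto simp: a_r_coset_def')
    then have "f y \<in> J' +>\<^bsub>B\<^esub> f x"
      using f_J x by (auto simp: a_r_coset_def' add J.Icarr)
    then show ?thesis
      using closed[OF x] J'.a_repr_independence[OF _ _ J'.a_subgroup] by simp
  qed
  moreover have "x \<in> J +>\<^bsub>A\<^esub> x"
    using x by (rule J.a_rcos_self)
  ultimately show ?thesis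
    unfolding coset_map_def by blast
qed

lemma ideal_smult_closed:
  assumes "kalgebra A" "ideal J A" "j \<in> J"
  shows "c \<odot>\<^bsub>A\<^esub> j \<in> J"
proof -
  interpret A: algebra "ring_of_type_algebra :: 'a ring" A by fact
  interpret J: ideal J A by fact
  have "c \<odot>\<^bsub>A\<^esub> j = (c \<odot>\<^bsub>A\<^esub> \<one>\<^bsub>A\<^esub>) \<otimes>\<^bsub>A\<^esub> j"
    using assms(3) J.Icarr by (simp add: A.smult_assoc2)
  then show ?thesis
    using assms(3) by (simp add: J.I_l_closed)
qed

lemma carrier_alg_quot: "carrier (alg_quot A J) = (\<lambda>x. J +>\<^bsub>A\<^esub> x) ` carrier A"
  by (auto simp: alg_quot_simps FactRing_def A_RCOSETS_def')

lemma alg_hom_coset: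
  assumes "kalgebra A" "ideal J A"
  shows "(\<lambda>x. J +>\<^bsub>A\<^esub> x) \<in> alg_hom A (alg_quot A J)"
proof -
  interpret A: algebra "ring_of_type_algebra :: 'a ring" A by fact
  have hom: "(\<lambda>x. J +>\<^bsub>A\<^esub> x) \<in> ring_hom A (A Quot J)"
    using assms(2) by (rule ideal.rcos_ring_hom)
  have smult: "coset_map A J (\<lambda>x. c \<odot>\<^bsub>A\<^esub> x) (J +>\<^bsub>A\<^esub> x) = J +>\<^bsub>A\<^esub> (c \<odot>\<^bsub>A\<^esub> x)" if "x \<in> carrier A" for c x
    using that assms by (intro coset_map_coset) (auto simp: A.smult_r_distr ideal_smult_closed)
  show ?thesis
    by (rule alg_homI) (use hom in \<open>auto simp: alg_quot_simps smult ring_hom_def\<close>)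
qed

lemma coset_zero:
  assumes "kalgebra A" "ideal J A"
  shows "J +>\<^bsub>A\<^esub> \<zero>\<^bsub>A\<^esub> = \<zero>\<^bsub>alg_quot A J\<^esub>"
proof -
  interpret J: ideal J A by fact
  show ?thesis
    by (simp add: alg_quot_simps FactRing_def J.a_coset_add_zero J.a_subset)
qed

lemma kalgebra_alg_quot: "kalgebra A \<Longrightarrow> ideal J A \<Longrightarrow> kalgebra (alg_quot A J)"
  by (rule kalgebra_surj_image[OF _ alg_hom_coset coset_zero carrier_alg_quot])

lemma coset_eq_zero_iff:
  assumes "kalgebra A" "ideal J A" "x \<in> carrier A"
  shows "J +>\<^bsub>A\<^esub> x = \<zero>\<^bsub>alg_quot A J\<^esub> \<longleftrightarrow> x \<in> J"
proof -
  interpret J: ideal J A by fact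
  show ?thesis
    using assms(3) J.a_rcos_self[of x] J.a_rcos_const[of x]
    by (auto simp: alg_quot_simps FactRing_def)
qed

lemma alg_hom_coset_map:
  assumes A: "kalgebra A" "ideal I A" and B: "kalgebra B" "ideal J B"
    and f: "f \<in> alg_hom A B" and "f ` I \<subseteq> J"
  shows "coset_map B J f \<in> alg_hom (alg_quot A I) (alg_quot B J)"
    and "x \<in> carrier A \<Longrightarrow> coset_map B J f (I +>\<^bsub>A\<^esub> x) = J +>\<^bsub>B\<^esub> f x"
proof -
  interpret A: algebra "ring_of_type_algebra :: 'a ring" A by fact
  have eq: "coset_map B J f (I +>\<^bsub>A\<^esub> x) = J +>\<^bsub>B\<^esub> f x" if "x \<in> carrier A" for x
    using that assms by (intro coset_map_coset) (auto simp: alg_homD[OF f])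
  then show "x \<in> carrier A \<Longrightarrow> coset_map B J f (I +>\<^bsub>A\<^esub> x) = J +>\<^bsub>B\<^esub> f x" .
  note a = alg_homD[OF alg_hom_coset[OF A]] and b = alg_homD[OF alg_hom_coset[OF B]]
  show "coset_map B J f \<in> alg_hom (alg_quot A I) (alg_quot B J)"
    by (rule alg_homI)
       (auto simp: carrier_alg_quot eq alg_homD[OF f] b(2-5)[symmetric] a(2-5)[symmetric])
qed

lemma comm_diff_algebra_alg_quot:
  assumes "comm_diff_algebra A lam d" "diff_ideal A d J"
  shows "comm_diff_algebra (alg_quot A J) lam (coset_map A J d)"
    and "x \<in> carrier A \<Longrightarrow> coset_map A J d (J +>\<^bsub>A\<^esub> x) = J +>\<^bsub>A\<^esub> d x"
proof -
  interpret A: comm_diff_algebra A lam d by fact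
  have J: "ideal J A" "d ` J \<subseteq> J"
    using assms(2) by (auto simp: diff_ideal_def)
  have A: "kalgebra A"
    by (rule A.algebra_axioms)
  have eq: "coset_map A J d (J +>\<^bsub>A\<^esub> x) = J +>\<^bsub>A\<^esub> d x" if "x \<in> carrier A" for x
    using that J by (intro coset_map_coset) (auto simp: A.d_closed A.d_add)
  then show "x \<in> carrier A \<Longrightarrow> coset_map A J d (J +>\<^bsub>A\<^esub> x) = J +>\<^bsub>A\<^esub> d x" .
  note hom = alg_homD[OF alg_hom_coset[OF A J(1)]]
  show "comm_diff_algebra (alg_quot A J) lam (coset_map A J d)"
    using kalgebra_alg_quot[OF A J(1)]
    unfolding comm_diff_algebra_def comm_diff_algebra_axioms_def
    by (auto simp: carrier_alg_quot eq A.d_closed A.d_add A.d_smult A.d_mult A.d_one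
        hom(2-5)[symmetric] coset_zero[OF A J(1), symmetric])
qed

lemma diff_ideal_DI:
  assumes "comm_diff_algebra A lam d" "U \<subseteq> carrier A"
  shows "diff_ideal A d (DI A d U)" and "U \<subseteq> DI A d U"
proof -
  interpret A: comm_diff_algebra A lam d by fact
  \<comment> \<open>The whole algebra witnesses that the family intersected in \<open>DI\<close> is
    nonempty.\<close>
  have "diff_ideal A d (carrier A)"
    using A.d_closed by (auto simp: diff_ideal_def A.oneideal)
  then have "ideal (DI A d U) A"
    unfolding DI_def using assms(2) by (intro A.i_Intersect) (auto simp: diff_ideal_def)
  then show "diff_ideal A d (DI A d U)"
    by (auto simp: diff_ideal_def DI_def)
  show "U \<subseteq> DI A d U"
    by (auto simp: DI_def)
qed

lemma DI_minimal: "diff_ideal A d J \<Longrightarrow> U \<subseteq> J \<Longrightarrow> DI A d U \<subseteq> J"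
  by (auto simp: DI_def)

section \<open>Evaluation of polynomials\<close>

locale poly_evaluation = algebra "ring_of_type_algebra :: 'k::field ring" R
  for R :: "('k::field, 'r) module" (structure) +
  fixes Y :: "'y set" and a :: "'y \<Rightarrow> 'r"
  assumes a_closed: "y \<in> Y \<Longrightarrow> a y \<in> carrier R"
begin

definition evaluate_mon :: "'y multiset \<Rightarrow> 'r" where
  "evaluate_mon u = (\<Otimes>y\<in>set_mset u. a y [^] count u y)"

definition evaluate :: "('y, 'k) mpoly \<Rightarrow> 'r" where
  "evaluate p = (\<Oplus>u\<in>Poly_Mapping.keys p. Poly_Mapping.lookup p u \<odot>\<^bsub>R\<^esub> evaluate_mon u)"

text \<open>Two monomials and their product can now be written over one common index set, where
  exponents add letter by letter.\<close>

lemma evaluate_mon_superset: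
  assumes "finite B" "set_mset u \<subseteq> B" "B \<subseteq> Y"
  shows "evaluate_mon u = (\<Otimes>y\<in>B. a y [^] count u y)"
  unfolding evaluate_mon_def
  by (rule finprod_mono_neutral_cong_left) (use assms a_closed in \<open>auto simp: not_in_iff\<close>)

lemma evaluate_mon_closed: "u \<in> mons Y \<Longrightarrow> evaluate_mon u \<in> carrier R"
  unfolding evaluate_mon_def by (rule finprod_closed) (auto simp: mons_def a_closed)

lemma evaluate_mon_add:
  assumes "u \<in> mons Y" "v \<in> mons Y"
  shows "evaluate_mon (u + v) = evaluate_mon u \<otimes> evaluate_mon v"
proof -
  let ?B = "set_mset u \<union> set_mset v"
  have "evaluate_mon w = (\<Otimes>y\<in>?B. a y [^] count w y)" if "set_mset w \<subseteq> ?B" for w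
    using assms that by (intro evaluate_mon_superset) (auto simp: mons_def)
  then have *: "evaluate_mon u = (\<Otimes>y\<in>?B. a y [^] count u y)" "evaluate_mon v = (\<Otimes>y\<in>?B. a y [^] count v y)"
    "evaluate_mon (u + v) = (\<Otimes>y\<in>?B. a y [^] count (u + v) y)"
    by simp_all
  have "(\<Otimes>y\<in>?B. a y [^] count (u + v) y) = (\<Otimes>y\<in>?B. a y [^] count u y \<otimes> a y [^] count v y)"
    using assms by (intro finprod_cong') (auto simp: mons_def a_closed nat_pow_mult)
  also have "\<dots> = (\<Otimes>y\<in>?B. a y [^] count u y) \<otimes> (\<Otimes>y\<in>?B. a y [^] count v y)"
    using assms by (intro finprod_multf) (auto simp: mons_def a_closed)
  finally show ?thesis
    by (simp only: *)
qed

lemma evaluate_mon_empty: "evaluate_mon {#} = \<one>"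
  by (simp add: evaluate_mon_def)

lemma evaluate_mon_single: "y \<in> Y \<Longrightarrow> evaluate_mon {#y#} = a y"
  using a_closed[of y] by (simp add: evaluate_mon_def)

lemma evaluate_superset:
  assumes "finite B" "Poly_Mapping.keys p \<subseteq> B" "B \<subseteq> mons Y"
  shows "evaluate p = (\<Oplus>u\<in>B. Poly_Mapping.lookup p u \<odot>\<^bsub>R\<^esub> evaluate_mon u)"
  unfolding evaluate_def
  by (rule add.finprod_mono_neutral_cong_left)
     (use assms smult_l_null in \<open>auto simp: in_keys_iff ring_of_type_algebra_def intro!: smult_closed evaluate_mon_closed\<close>)

lemma evaluate_closed: "Poly_Mapping.keys p \<subseteq> mons Y \<Longrightarrow> evaluate p \<in> carrier R"
  unfolding evaluate_def by (rule finsum_closed) (auto intro!: smult_closed evaluate_mon_closed)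

lemma evaluate_add:
  assumes "Poly_Mapping.keys p \<subseteq> mons Y" "Poly_Mapping.keys q \<subseteq> mons Y"
  shows "evaluate (p + q) = evaluate p \<oplus> evaluate q"
proof -
  let ?B = "Poly_Mapping.keys p \<union> Poly_Mapping.keys q"
  let ?f = "\<lambda>p u. Poly_Mapping.lookup p u \<odot>\<^bsub>R\<^esub> evaluate_mon u"
  have "evaluate s = (\<Oplus>u\<in>?B. ?f s u)" if "Poly_Mapping.keys s \<subseteq> ?B" for s
    using assms that by (intro evaluate_superset) auto
  then have *: "evaluate p = (\<Oplus>u\<in>?B. ?f p u)" "evaluate q = (\<Oplus>u\<in>?B. ?f q u)"
    "evaluate (p + q) = (\<Oplus>u\<in>?B. ?f (p + q) u)"
    using keys_add[of p q] by simp_all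
  have closed: "?f s u \<in> carrier R" if "u \<in> ?B" for s u
    using that assms by (intro smult_closed evaluate_mon_closed) auto
  have "?f (p + q) u = ?f p u \<oplus> ?f q u" if "u \<in> ?B" for u
    using that assms evaluate_mon_closed[of u] smult_l_distr[of "Poly_Mapping.lookup p u" "Poly_Mapping.lookup q u"]
    by (auto simp: lookup_add ring_of_type_algebra_def)
  then have "(\<Oplus>u\<in>?B. ?f (p + q) u) = (\<Oplus>u\<in>?B. ?f p u \<oplus> ?f q u)"
    using closed by (intro finsum_cong') auto
  also have "\<dots> = (\<Oplus>u\<in>?B. ?f p u) \<oplus> (\<Oplus>u\<in>?B. ?f q u)"
    using closed by (intro finsum_addf) auto
  finally show ?thesis
    by (simp only: *)
qed

lemma evaluate_single:
  assumes "u \<in> mons Y"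
  shows "evaluate (Poly_Mapping.single u c) = c \<odot>\<^bsub>R\<^esub> evaluate_mon u"
  using evaluate_superset[of "{u}" "Poly_Mapping.single u c"] assms
  by (simp add: smult_closed evaluate_mon_closed)

lemma smult_mult_smult:
  assumes "x \<in> carrier R" "y \<in> carrier R"
  shows "(c \<odot>\<^bsub>R\<^esub> x) \<otimes> (e \<odot>\<^bsub>R\<^esub> y) = (c * e) \<odot>\<^bsub>R\<^esub> (x \<otimes> y)"
proof -
  have "x \<otimes> (e \<odot>\<^bsub>R\<^esub> y) = e \<odot>\<^bsub>R\<^esub> (x \<otimes> y)"
    using assms smult_assoc2[of e y x] by (simp add: smult_closed m_comm)
  moreover have "(c \<odot>\<^bsub>R\<^esub> x) \<otimes> (e \<odot>\<^bsub>R\<^esub> y) = c \<odot>\<^bsub>R\<^esub> (x \<otimes> (e \<odot>\<^bsub>R\<^esub> y))"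
    using assms by (simp add: smult_assoc2 smult_closed)
  ultimately show ?thesis
    using assms smult_assoc1[of c e "x \<otimes> y"] by (simp add: ring_of_type_algebra_def)
qed

lemma evaluate_mult:
  assumes "Poly_Mapping.keys p \<subseteq> mons Y" "Poly_Mapping.keys q \<subseteq> mons Y"
  shows "evaluate (p * q) = evaluate p \<otimes> evaluate q"
  using assms
proof (induction p rule: mpoly_induct)
  case (single u c)
  from \<open>Poly_Mapping.keys q \<subseteq> mons Y\<close> show ?case
  proof (induction q rule: mpoly_induct)
    case (single v e)
    have "evaluate (Poly_Mapping.single (u + v) (c * e)) = (c * e) \<odot>\<^bsub>R\<^esub> (evaluate_mon u \<otimes> evaluate_mon v)"
      using \<open>u \<in> mons Y\<close> single by (subst evaluate_single) (auto simp: mons_def evaluate_mon_add)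
    also have "\<dots> = (c \<odot>\<^bsub>R\<^esub> evaluate_mon u) \<otimes> (e \<odot>\<^bsub>R\<^esub> evaluate_mon v)"
      using \<open>u \<in> mons Y\<close> single by (simp add: smult_mult_smult evaluate_mon_closed)
    finally show ?case
      using \<open>u \<in> mons Y\<close> single by (simp add: mult_single evaluate_single)
  next
    case (add q1 q2)
    have s: "Poly_Mapping.keys (Poly_Mapping.single u c) \<subseteq> mons Y"
      using \<open>u \<in> mons Y\<close> by simp
    show ?case
      using add s by (simp add: distrib_left evaluate_add keys_mult_closed evaluate_closed r_distr)
  qed
next
  case (add p1 p2)
  then show ?case
    by (simp add: distrib_right evaluate_add keys_mult_closed evaluate_closed l_distr)
qed

lemma evaluate_alg_hom: "evaluate \<in> alg_hom (poly_alg Y) R"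
proof (rule alg_homI)
  have empty: "{#} \<in> mons Y"
    by (simp add: mons_def)
  have cst: "evaluate (cst c) = c \<odot>\<^bsub>R\<^esub> \<one>" for c
    using evaluate_single[OF empty] by (simp add: evaluate_mon_empty)
  have one: "(1 :: 'k) \<odot>\<^bsub>R\<^esub> \<one> = \<one>"
    using smult_one[of \<one>] by (simp add: ring_of_type_algebra_def)
  show "evaluate \<one>\<^bsub>poly_alg Y\<^esub> = \<one>"
    using cst[of 1] by (simp add: one)
  show "evaluate (c \<odot>\<^bsub>poly_alg Y\<^esub> x) = c \<odot>\<^bsub>R\<^esub> evaluate x" if "x \<in> carrier (poly_alg Y)" for c x
    using that empty by (simp add: evaluate_mult cst smult_assoc2 evaluate_closed)
qed (simp_all add: evaluate_closed evaluate_mult evaluate_add)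

lemma evaluate_var: "y \<in> Y \<Longrightarrow> evaluate (mon {#y#}) = a y"
  using smult_one[of "a y"] a_closed[of y] evaluate_single[of "{#y#}" 1]
  by (simp add: mons_def evaluate_mon_single ring_of_type_algebra_def)

end

lemma alg_hom_poly_alg_eqI:
  fixes g h :: "('y, 'k::field) mpoly \<Rightarrow> 'r"
  assumes g: "g \<in> alg_hom (poly_alg Y) R" and h: "h \<in> alg_hom (poly_alg Y) R"
    and eq: "\<And>y. y \<in> Y \<Longrightarrow> g (mon {#y#}) = h (mon {#y#})"
    and p: "p \<in> carrier (poly_alg Y)"
  shows "g p = h p"
proof -
  have eq_mon: "g (mon u) = h (mon u)" if "u \<in> mons Y" for u
    using that
  proof (induction u)
    case empty
    then show ?case
      using alg_homD(4)[OF g] alg_homD(4)[OF h] by simp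
  next
    case (add y u)
    then have "y \<in> Y" "u \<in> mons Y"
      by (auto simp: mons_def)
    moreover have "mon (add_mset y u) = (mon {#y#} * mon u :: ('y, 'k) mpoly)"
      by (simp add: mult_single)
    ultimately show ?case
      using add.IH eq alg_homD(2)[OF g, of "mon {#y#}" "mon u"] alg_homD(2)[OF h, of "mon {#y#}" "mon u"]
      by (simp add: mons_def)
  qed
  have "Poly_Mapping.keys p \<subseteq> mons Y"
    using p by simp
  then show ?thesis
  proof (induction p rule: mpoly_induct)
    case (single u c)
    then show ?case
      using alg_homD(5)[OF g, of "mon u" c] alg_homD(5)[OF h, of "mon u" c] eq_mon
      by (simp add: mult_single)
  next
    case (add p q)
    then show ?case
      using alg_homD(3)[OF g] alg_homD(3)[OF h] by simp
  qed
qed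


section \<open>The universal property\<close>

lemma i_hat_alg_hom: "i_hat \<in> alg_hom (poly_alg Xs) (poly_alg (Delta Xs))"
  by (rule alg_homI) (simp_all add: i_hat_closed i_hat_mult i_hat_add)

lemma funpow_der_var: "(der lam ^^ n) (mon {#(0, x)#}) = mon {#(n, x)#}"
  by (induction n) (simp_all add: der_single)

lemma diff_alg_hom_funpow:
  assumes h: "h \<in> diff_alg_hom A dA B dB" and closed: "\<And>x. x \<in> carrier A \<Longrightarrow> dA x \<in> carrier A"
    and x: "x \<in> carrier A"
  shows "(dA ^^ n) x \<in> carrier A" "h ((dA ^^ n) x) = (dB ^^ n) (h x)"
proof -
  show "(dA ^^ n) x \<in> carrier A" for n
    by (induction n) (simp_all add: x closed)
  then show "h ((dA ^^ n) x) = (dB ^^ n) (h x)"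
    using h by (induction n) (auto simp: diff_alg_hom_def)
qed

lemma diff_alg_hom_poly_alg_eqI:
  fixes Xs :: "'x::linorder set" and lam :: "'k::field"
  assumes g: "g \<in> diff_alg_hom (poly_alg (Delta Xs)) (der lam) R d"
    and h: "h \<in> diff_alg_hom (poly_alg (Delta Xs)) (der lam) R d"
    and eq: "\<And>x. x \<in> Xs \<Longrightarrow> g (mon {#(0, x)#}) = h (mon {#(0, x)#})"
    and "p \<in> carrier (poly_alg (Delta Xs))"
  shows "g p = h p"
proof (rule alg_hom_poly_alg_eqI)
  show "g \<in> alg_hom (poly_alg (Delta Xs)) R" "h \<in> alg_hom (poly_alg (Delta Xs)) R"
    using g h by (auto simp: diff_alg_hom_def)
  fix y assume "y \<in> Delta Xs"
  then obtain n x where y: "y = (n, x)" "x \<in> Xs"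
    by (auto simp: Delta_def)
  have var: "f (mon {#y#}) = (d ^^ n) (f (mon {#(0, x)#}))"
    if "f \<in> diff_alg_hom (poly_alg (Delta Xs)) (der lam) R d" for f
  proof -
    have "der lam p \<in> carrier (poly_alg (Delta Xs))" if "p \<in> carrier (poly_alg (Delta Xs))" for p
      using that by (simp add: keys_der)
    moreover have "mon {#(0, x)#} \<in> carrier (poly_alg (Delta Xs) :: ('k, (nat \<times> 'x, 'k) mpoly) module)"
      using y(2) by (simp add: mons_def Delta_def)
    ultimately show ?thesis
      using diff_alg_hom_funpow(2)[OF that] by (metis funpow_der_var y(1))
  qed
  show "g (mon {#y#}) = h (mon {#y#})"
    using var[OF g] var[OF h] eq[OF y(2)] by simp
qed fact

text \<open>Commuting with the operators forces the value \<open>(d ^^ n) (b x)\<close> on the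
  letter \<open>(n, x)\<close>. Evaluation at these values commutes with the operators on words,
  because \<open>der_word\<close> unfolds the Leibniz rule that \<open>d\<close> satisfies, and then
  everywhere by linearity.\<close>

lemma ex_diff_alg_hom_poly_alg:
  fixes Xs :: "'x::linorder set" and lam :: "'k::field"
  assumes "comm_diff_algebra R lam d" and b: "\<And>x. x \<in> Xs \<Longrightarrow> b x \<in> carrier R"
  obtains h where "h \<in> diff_alg_hom (poly_alg (Delta Xs)) (der lam) R d"
    "\<And>x. x \<in> Xs \<Longrightarrow> h (mon {#(0, x)#}) = b x"
proof -
  interpret R: comm_diff_algebra R lam d by fact
  have pow_closed: "(d ^^ n) (b x) \<in> carrier R" if "x \<in> Xs" for n x
    using that by (induction n) (simp_all add: b R.d_closed)
  interpret E: poly_evaluation R "Delta Xs" "\<lambda>(n, x). (d ^^ n) (b x)"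
    by unfold_locales (use pow_closed in \<open>auto simp: Delta_def\<close>)
  interpret P: comm_diff_algebra "poly_alg (Delta Xs) :: ('k, (nat \<times> 'x, 'k) mpoly) module" lam "der lam"
    by (rule der_characterization(1))
  note hom = alg_homD[OF E.evaluate_alg_hom]
  have zero: "E.evaluate 0 = \<zero>\<^bsub>R\<^esub>"
    using alg_hom_zero[OF P.algebra_axioms R.algebra_axioms E.evaluate_alg_hom] by simp

  have word: "E.evaluate (der_word lam ys) = d (E.evaluate (mon (mset ys)))" if "set ys \<subseteq> Delta Xs" for ys
    using that
  proof (induction ys)
    case Nil
    then show ?case
      using hom(4) by (simp add: zero R.d_one)
  next
    case (Cons y ys)
    obtain n x where y: "y = (n, x)"
      by fastforce
    then have x: "x \<in> Xs"
      using Cons.prems by (auto simp: Delta_def)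
    let ?v = "\<lambda>n. mon {#(n, x)#} :: (nat \<times> 'x, 'k) mpoly" and ?m = "mon (mset ys) :: (nat \<times> 'x, 'k) mpoly"
    let ?w = "der_word lam ys"
    have v: "?v n \<in> carrier (poly_alg (Delta Xs))" for n
      using x by (simp add: mons_def Delta_def)
    have m: "?m \<in> carrier (poly_alg (Delta Xs))"
      using Cons.prems by (simp add: mons_def)
    have w: "?w \<in> carrier (poly_alg (Delta Xs))"
      using keys_der_word[of ys Xs lam] Cons.prems by simp
    have evaluate_v: "E.evaluate (?v n) = (d ^^ n) (b x)" for n
      using E.evaluate_var[of "(n, x)"] x by (simp add: Delta_def)
    have IH: "E.evaluate ?w = d (E.evaluate ?m)"
      using Cons by simp
    have "E.evaluate (der_word lam (y # ys)) = E.evaluate (?v (Suc n) \<otimes>\<^bsub>poly_alg (Delta Xs)\<^esub> ?m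
        \<oplus>\<^bsub>poly_alg (Delta Xs)\<^esub> ?v n \<otimes>\<^bsub>poly_alg (Delta Xs)\<^esub> ?w
        \<oplus>\<^bsub>poly_alg (Delta Xs)\<^esub> lam \<odot>\<^bsub>poly_alg (Delta Xs)\<^esub> (?v (Suc n) \<otimes>\<^bsub>poly_alg (Delta Xs)\<^esub> ?w))"
      by (simp add: y)
    also have "\<dots> = E.evaluate (?v (Suc n)) \<otimes>\<^bsub>R\<^esub> E.evaluate ?m \<oplus>\<^bsub>R\<^esub> E.evaluate (?v n) \<otimes>\<^bsub>R\<^esub> E.evaluate ?w
        \<oplus>\<^bsub>R\<^esub> lam \<odot>\<^bsub>R\<^esub> (E.evaluate (?v (Suc n)) \<otimes>\<^bsub>R\<^esub> E.evaluate ?w)"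
      using v m w
      by (simp only: hom(2,3,5) P.m_closed P.add.m_closed P.smult_closed carrier_ring_of_type_algebra UNIV_I)
    \<comment> \<open>This is the Leibniz rule of \<open>R\<close> read backwards, with
      \<open>(d ^^ Suc n) (b x)\<close> as the derivative of \<open>(d ^^ n) (b x)\<close>.\<close>
    also have "\<dots> = d (E.evaluate (?v n) \<otimes>\<^bsub>R\<^esub> E.evaluate ?m)"
      using hom(1)[OF v] hom(1)[OF m] by (simp add: R.d_mult IH evaluate_v)
    also have "E.evaluate (?v n) \<otimes>\<^bsub>R\<^esub> E.evaluate ?m = E.evaluate (mon (mset (y # ys)))"
      using hom(2)[OF v m] by (simp add: y mult_single)
    finally show ?case .
  qed
  have der: "E.evaluate (der lam p) = d (E.evaluate p)" if "Poly_Mapping.keys p \<subseteq> mons (Delta Xs)" for p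
    using that
  proof (induction p rule: mpoly_induct)
    case (single u c)
    have u: "mon u \<in> carrier (poly_alg (Delta Xs) :: ('k, (nat \<times> 'x, 'k) mpoly) module)"
      using single by simp
    have "E.evaluate (der lam (mon u)) = d (E.evaluate (mon u))"
      using single word[of "sorted_list_of_multiset u"] by (simp add: der_single mons_def)
    then have "E.evaluate (der lam (c \<odot>\<^bsub>poly_alg (Delta Xs)\<^esub> mon u)) = c \<odot>\<^bsub>R\<^esub> d (E.evaluate (mon u))"
      by (simp only: P.d_smult[OF u] hom(5)[OF P.d_closed[OF u]])
    also have "\<dots> = d (E.evaluate (c \<odot>\<^bsub>poly_alg (Delta Xs)\<^esub> mon u))"
      using single hom(1)[of "mon u"] hom(5)[of "mon u" c] by (simp add: R.d_smult)
    finally show ?case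
      by (simp add: mult_single)
  next
    case (add p q)
    then show ?case
      by (simp add: der_add E.evaluate_add keys_der R.d_add E.evaluate_closed)
  qed
  have "E.evaluate \<in> diff_alg_hom (poly_alg (Delta Xs)) (der lam) R d"
    using E.evaluate_alg_hom der by (simp add: diff_alg_hom_def)
  moreover have "E.evaluate (mon {#(0, x)#}) = b x" if "x \<in> Xs" for x
    using E.evaluate_var[of "(0, x)"] that by (simp add: Delta_def)
  ultimately show ?thesis
    using that by blast
qed

text \<open>Both ideals are minimal over their generators, so a map factors through either quotient
  once its kernel is of the right kind and contains the generators.\<close>

lemma free_comm_diff_algebra_quot:
  fixes lam :: "'k::field" and Xs :: "'x::linorder set"
  assumes S: "S \<subseteq> carrier (poly_alg Xs)"
  defines "P \<equiv> poly_alg (Delta Xs)" and "I \<equiv> Idl\<^bsub>poly_alg Xs\<^esub> S"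
  defines "J \<equiv> DI P (der lam) (i_hat ` S)"
  shows "free_comm_diff_algebra TYPE('r) lam (alg_quot (poly_alg Xs) I)
    (alg_quot P J) (coset_map P J (der lam)) (coset_map P J i_hat)"
proof -
  let ?P0 = "poly_alg Xs :: ('k, ('x, 'k) mpoly) module"
  let ?A = "alg_quot ?P0 I" and ?Q = "alg_quot P J"
  let ?dQ = "coset_map P J (der lam)" and ?iQ = "coset_map P J i_hat"
  have P0: "kalgebra ?P0"
    by (rule algebra_poly_alg)
  interpret P0: algebra "ring_of_type_algebra :: 'k ring" ?P0
    by (rule P0)
  interpret P: comm_diff_algebra P lam "der lam"
    unfolding P_def by (rule der_characterization(1))
  have P: "kalgebra P"
    by (rule P.algebra_axioms)
  have I: "ideal I ?P0" "S \<subseteq> I"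
    unfolding I_def using S by (rule P0.genideal_ideal, rule P0.genideal_self)
  have I_minimal: "I \<subseteq> K" if "ideal K ?P0" "S \<subseteq> K" for K
    unfolding I_def using that by (rule P0.genideal_minimal)
  have i_hat: "i_hat \<in> alg_hom ?P0 P"
    unfolding P_def by (rule i_hat_alg_hom)
  have "i_hat ` S \<subseteq> carrier P"
    using S alg_homD(1)[OF i_hat] by blast
  from diff_ideal_DI[OF P.comm_diff_algebra_axioms this]
  have J: "diff_ideal P (der lam) J" "i_hat ` S \<subseteq> J"
    by (simp_all add: J_def)
  then have J_ideal: "ideal J P"
    by (simp add: diff_ideal_def)
  note Q = comm_diff_algebra_alg_quot[OF P.comm_diff_algebra_axioms J(1)]
  have Q_alg: "kalgebra ?Q"
    using P J_ideal by (rule kalgebra_alg_quot)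
  note coset = alg_hom_coset[OF P J_ideal]
  have coset_diff: "(\<lambda>p. J +>\<^bsub>P\<^esub> p) \<in> diff_alg_hom P (der lam) ?Q ?dQ"
    using coset Q(2) by (simp add: diff_alg_hom_def)

  \<comment> \<open>Minimality of \<open>I\<close> carries \<open>i_hat s \<in> J\<close> from the
    generators to the whole ideal, which makes \<open>i_hat\<close> descend to cosets.\<close>
  have "I \<subseteq> {p \<in> carrier ?P0. J +>\<^bsub>P\<^esub> i_hat p = \<zero>\<^bsub>?Q\<^esub>}"
  proof (rule I_minimal)
    show "ideal {p \<in> carrier ?P0. J +>\<^bsub>P\<^esub> i_hat p = \<zero>\<^bsub>?Q\<^esub>} ?P0"
      using P0 Q_alg alg_hom_comp[OF i_hat coset] by (rule ideal_kernel_alg_hom)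
    show "S \<subseteq> {p \<in> carrier ?P0. J +>\<^bsub>P\<^esub> i_hat p = \<zero>\<^bsub>?Q\<^esub>}"
      using S J(2) alg_homD(1)[OF i_hat] coset_eq_zero_iff[OF P J_ideal] by blast
  qed
  then have i_hat_I: "i_hat ` I \<subseteq> J"
    using alg_homD(1)[OF i_hat] coset_eq_zero_iff[OF P J_ideal] by blast
  note iQ = alg_hom_coset_map[OF P0 I(1) P J_ideal i_hat i_hat_I]

  have "\<exists>!\<psi>. \<psi> \<in> extensional (carrier ?Q) \<and> \<psi> \<in> diff_alg_hom ?Q ?dQ R d \<and>
      (\<forall>a\<in>carrier ?A. \<psi> (?iQ a) = \<phi> a)"
    if R: "comm_diff_algebra R lam d" and \<phi>: "\<phi> \<in> alg_hom ?A R"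
    for R :: "('k, 'r) module" and d \<phi>
  proof -
    interpret R: comm_diff_algebra R lam d by (rule R)
    have R_alg: "kalgebra R"
      by (rule R.algebra_axioms)
    define \<phi>' where "\<phi>' p = \<phi> (I +>\<^bsub>?P0\<^esub> p)" for p
    have \<phi>': "\<phi>' \<in> alg_hom ?P0 R"
      unfolding \<phi>'_def using alg_hom_coset[OF P0 I(1)] \<phi> by (rule alg_hom_comp)
    have var_P0: "mon {#x#} \<in> carrier ?P0" if "x \<in> Xs" for x
      using that by (simp add: mons_def)
    obtain h where h: "h \<in> diff_alg_hom P (der lam) R d"
      and h_var: "\<And>x. x \<in> Xs \<Longrightarrow> h (mon {#(0, x)#}) = \<phi>' (mon {#x#})"
      using ex_diff_alg_hom_poly_alg[OF R, of Xs "\<lambda>x. \<phi>' (mon {#x#})"] alg_homD(1)[OF \<phi>' var_P0]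
      unfolding P_def by blast
    have h_alg: "h \<in> alg_hom P R" and h_der: "\<And>p. p \<in> carrier P \<Longrightarrow> h (der lam p) = d (h p)"
      using h by (auto simp: diff_alg_hom_def)
    note h_zero = alg_hom_zero[OF P R_alg h_alg]
    have d_zero: "d \<zero>\<^bsub>R\<^esub> = \<zero>\<^bsub>R\<^esub>"
      using h_der[of "\<zero>\<^bsub>P\<^esub>"] by (simp add: P_def flip: h_zero)
    have h_i_hat: "h (i_hat p) = \<phi>' p" if "p \<in> carrier ?P0" for p
      using alg_hom_comp[OF i_hat h_alg] \<phi>' _ that
      by (rule alg_hom_poly_alg_eqI) (simp add: h_var)
    have \<phi>'_I: "\<phi>' p = \<zero>\<^bsub>R\<^esub>" if "p \<in> I" for p
    proof -
      interpret I: ideal I ?P0 by (rule I(1))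
      show ?thesis
        using coset_eq_zero_iff[OF P0 I(1) I.Icarr[OF that]] that
          alg_hom_zero[OF kalgebra_alg_quot[OF P0 I(1)] R_alg \<phi>]
        by (simp add: \<phi>'_def)
    qed
    have "diff_ideal P (der lam) {p \<in> carrier P. h p = \<zero>\<^bsub>R\<^esub>}"
      using ideal_kernel_alg_hom[OF P R_alg h_alg] P.d_closed h_der d_zero by (auto simp: diff_ideal_def)
    moreover have "i_hat ` S \<subseteq> {p \<in> carrier P. h p = \<zero>\<^bsub>R\<^esub>}"
      using S I(2) alg_homD(1)[OF i_hat] h_i_hat \<phi>'_I by (auto simp: subset_iff)
    ultimately have h_J: "h p = \<zero>\<^bsub>R\<^esub>" if "p \<in> J" for p
      using DI_minimal that unfolding J_def by blast
    have h_coset: "h q = h p" if "q \<in> J +>\<^bsub>P\<^esub> p" "p \<in> carrier P" for p q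
    proof -
      interpret J: ideal J P by (rule J_ideal)
      obtain j where "j \<in> J" "q = j \<oplus>\<^bsub>P\<^esub> p"
        using \<open>q \<in> J +>\<^bsub>P\<^esub> p\<close> by (auto simp: a_r_coset_def')
      then show ?thesis
        using that(2) J.Icarr alg_homD(1,3)[OF h_alg] h_J by simp
    qed
    \<comment> \<open>The choice of representative is harmless by \<open>h_coset\<close>; the
      restriction makes the map extensional, as the uniqueness clause demands.\<close>
    define \<psi> where "\<psi> = restrict (\<lambda>K. h (SOME p. p \<in> K)) (carrier ?Q)"
    have \<psi>_coset: "\<psi> (J +>\<^bsub>P\<^esub> p) = h p" if "p \<in> carrier P" for p
    proof -
      interpret J: ideal J P by (rule J_ideal)
      have "(SOME q. q \<in> J +>\<^bsub>P\<^esub> p) \<in> J +>\<^bsub>P\<^esub> p"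
        using J.a_rcos_self[OF that] by (rule someI)
      then show ?thesis
        using that by (auto simp: \<psi>_def carrier_alg_quot intro: h_coset)
    qed
    note coset_ops = alg_homD(2-5)[OF coset, symmetric]
    have "\<psi> \<in> alg_hom ?Q R"
      by (rule alg_homI)
         (auto simp: carrier_alg_quot \<psi>_coset alg_homD[OF h_alg] coset_ops)
    then have "\<psi> \<in> diff_alg_hom ?Q ?dQ R d"
      by (auto simp: diff_alg_hom_def carrier_alg_quot Q(2) \<psi>_coset P.d_closed h_der)
    moreover have "\<psi> \<in> extensional (carrier ?Q)"
      by (simp add: \<psi>_def)
    moreover have "\<psi> (?iQ a) = \<phi> a" if "a \<in> carrier ?A" for a
      using that alg_homD(1)[OF i_hat] by (auto simp: carrier_alg_quot iQ(2) \<psi>_coset h_i_hat \<phi>'_def)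
    moreover have "\<psi>' = \<psi>"
      if ext: "\<psi>' \<in> extensional (carrier ?Q)" and \<psi>': "\<psi>' \<in> diff_alg_hom ?Q ?dQ R d"
        and fac: "\<forall>a\<in>carrier ?A. \<psi>' (?iQ a) = \<phi> a" for \<psi>'
    proof (rule extensionalityI[OF ext])
      show "\<psi> \<in> extensional (carrier ?Q)"
        by (simp add: \<psi>_def)
      \<comment> \<open>Uniqueness is decided upstairs: pulled back to \<open>P\<close>, the
        competitor is a differential homomorphism that agrees with \<open>h\<close> on the letters
        of order 0.\<close>
      have comp: "(\<lambda>p. \<psi>' (J +>\<^bsub>P\<^esub> p)) \<in> diff_alg_hom P (der lam) R d"
        using \<psi>' coset_diff alg_hom_comp[OF coset] alg_homD(1)[OF coset] by (auto simp: diff_alg_hom_def)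
      have "\<psi>' (J +>\<^bsub>P\<^esub> mon {#(0, x)#}) = h (mon {#(0, x)#})" if "x \<in> Xs" for x
      proof -
        have "I +>\<^bsub>?P0\<^esub> mon {#x#} \<in> carrier ?A"
          unfolding carrier_alg_quot using var_P0[OF that] by (rule imageI)
        with fac have "\<psi>' (?iQ (I +>\<^bsub>?P0\<^esub> mon {#x#})) = \<phi>' (mon {#x#})"
          unfolding \<phi>'_def by blast
        then show ?thesis
          using iQ(2)[OF var_P0[OF that]] h_var[OF that] by simp
      qed
      then have "\<psi>' (J +>\<^bsub>P\<^esub> p) = h p" if "p \<in> carrier P" for p
        using diff_alg_hom_poly_alg_eqI comp h that unfolding P_def by blast
      then show "\<psi>' K = \<psi> K" if "K \<in> carrier ?Q" for K
        using that by (auto simp: carrier_alg_quot \<psi>_coset)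
    qed
    ultimately show ?thesis
      by blast
  qed
  then show ?thesis
    unfolding free_comm_diff_algebra_def using Q(1) iQ(1) by blast
qed

section \<open>Uniqueness of the free object up to isomorphism\<close>

lemma diff_alg_hom_comp:
  assumes "g \<in> diff_alg_hom A dA B dB" "h \<in> diff_alg_hom B dB C dC"
  shows "(\<lambda>x. h (g x)) \<in> diff_alg_hom A dA C dC"
  using assms alg_hom_comp[of g A B h C] alg_homD(1)[of g A B] by (auto simp: diff_alg_hom_def)

lemma diff_alg_hom_restrict:
  assumes "comm_diff_algebra A lam dA" "h \<in> diff_alg_hom A dA B dB"
  shows "restrict h (carrier A) \<in> diff_alg_hom A dA B dB"
proof -
  interpret A: comm_diff_algebra A lam dA by fact
  have h: "h \<in> alg_hom A B" "\<forall>x\<in>carrier A. h (dA x) = dB (h x)"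
    using assms(2) by (auto simp: diff_alg_hom_def)
  have "restrict h (carrier A) \<in> alg_hom A B"
    by (rule alg_homI) (simp_all add: alg_homD[OF h(1)] A.smult_closed)
  then show ?thesis
    using h(2) A.d_closed by (simp add: diff_alg_hom_def)
qed

text \<open>With \<open>C\<close> as its own test algebra and \<open>i\<close> as the map to be
  factored, both \<open>h\<close> and the identity are factorizations. They are restricted to the
  carrier because uniqueness speaks of extensional maps.\<close>

lemma free_comm_diff_algebra_endo_eq:
  fixes C :: "('k::field, 'c) module"
  assumes "free_comm_diff_algebra TYPE('c) lam A C dC i"
    and "h \<in> diff_alg_hom C dC C dC" "\<And>a. a \<in> carrier A \<Longrightarrow> h (i a) = i a"
    and x: "x \<in> carrier C"
  shows "h x = x"
proof -
  have C: "comm_diff_algebra C lam dC" and i: "i \<in> alg_hom A C"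
    and ex1: "\<exists>!\<psi>. \<psi> \<in> extensional (carrier C) \<and> \<psi> \<in> diff_alg_hom C dC C dC \<and>
      (\<forall>a\<in>carrier A. \<psi> (i a) = i a)"
    using assms(1) by (auto simp: free_comm_diff_algebra_def)
  interpret C: comm_diff_algebra C lam dC by (rule C)
  have "(\<lambda>x. x) \<in> diff_alg_hom C dC C dC"
    by (simp add: diff_alg_hom_def alg_homI)
  note id = diff_alg_hom_restrict[OF C this]
  have "restrict h (carrier C) = restrict (\<lambda>x. x) (carrier C)"
    using ex1 diff_alg_hom_restrict[OF C assms(2)] id alg_homD(1)[OF i] assms(3)
    by (elim ex1E) (metis (no_types, lifting) restrict_apply' restrict_extensional)
  then show ?thesis
    using x by (metis restrict_apply')
qed

lemma free_comm_diff_algebra_ex_hom: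
  fixes R :: "('k::field, 'r) module"
  assumes "free_comm_diff_algebra TYPE('r) lam A C dC i" "comm_diff_algebra R lam d" "\<phi> \<in> alg_hom A R"
  obtains \<psi> where "\<psi> \<in> diff_alg_hom C dC R d" "\<And>a. a \<in> carrier A \<Longrightarrow> \<psi> (i a) = \<phi> a"
  using assms unfolding free_comm_diff_algebra_def by blast

text \<open>The universal property is tied to a test type, so each object is tested against both
  carrier types: against the other one to obtain \<open>f\<close> and \<open>g\<close>, against its
  own to see that the round trips are identities.\<close>

lemma free_comm_diff_algebra_unique:
  fixes C :: "('k::field, 'c) module" and E :: "('k, 'e) module"
  assumes C: "free_comm_diff_algebra TYPE('c) lam A C dC i" "free_comm_diff_algebra TYPE('e) lam A C dC i"
    and E: "free_comm_diff_algebra TYPE('c) lam A E dE j" "free_comm_diff_algebra TYPE('e) lam A E dE j"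
  shows "diff_alg_isomorphic C dC E dE"
proof -
  have C': "comm_diff_algebra C lam dC" "i \<in> alg_hom A C" and E': "comm_diff_algebra E lam dE" "j \<in> alg_hom A E"
    using C(1) E(1) by (auto simp: free_comm_diff_algebra_def)
  obtain f where f: "f \<in> diff_alg_hom C dC E dE" "\<And>a. a \<in> carrier A \<Longrightarrow> f (i a) = j a"
    using free_comm_diff_algebra_ex_hom[OF C(2) E'] by blast
  obtain g where g: "g \<in> diff_alg_hom E dE C dC" "\<And>a. a \<in> carrier A \<Longrightarrow> g (j a) = i a"
    using free_comm_diff_algebra_ex_hom[OF E(1) C'] by blast
  have gf: "g (f x) = x" if "x \<in> carrier C" for x
    using C(1) diff_alg_hom_comp[OF f(1) g(1)] _ that
    by (rule free_comm_diff_algebra_endo_eq) (simp add: f(2) g(2))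
  have fg: "f (g x) = x" if "x \<in> carrier E" for x
    using E(2) diff_alg_hom_comp[OF g(1) f(1)] _ that
    by (rule free_comm_diff_algebra_endo_eq) (simp add: f(2) g(2))
  have "f \<in> alg_hom C E" "g \<in> alg_hom E C"
    using f(1) g(1) by (auto simp: diff_alg_hom_def)
  then have "bij_betw f (carrier C) (carrier E)"
    by (intro bij_betwI[where g = g]) (auto simp: gf fg alg_homD(1))
  then show ?thesis
    using f(1) by (auto simp: diff_alg_isomorphic_def)
qed

theorem theorem3p3:
  fixes lam :: "'k::field_char_0"
    and Xs :: "'x::wellorder set"
    and I_A S_A :: "('x, 'k) mpoly set"
  assumes "lam \<noteq> 0"
    and "ideal I_A (poly_alg Xs)"
    and "gs_basis Xs S_A"
    and "I_A = Idl\<^bsub>poly_alg Xs\<^esub> S_A"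
  shows "let A = alg_quot (poly_alg Xs) I_A;
             S_hat = i_hat ` S_A;
             P = poly_alg (Delta Xs);
             J = DI P (der lam) S_hat;
             Q = alg_quot P J;
             d_Q = coset_map P J (der lam);
             i_Q = coset_map P J i_hat
         in diff_gs_basis lam Xs S_hat \<and>
            free_comm_diff_algebra TYPE('r) lam A Q d_Q i_Q \<and>
            (\<forall>(CD :: ('k, 'c) module) d_CD i_CD.
               free_comm_diff_algebra TYPE('c) lam A CD d_CD i_CD \<and>
               free_comm_diff_algebra TYPE((nat \<times> 'x, 'k) mpoly set) lam A CD d_CD i_CD \<longrightarrow>
               diff_alg_isomorphic CD d_CD Q d_Q)"
  unfolding Let_def
proof (intro conjI allI impI)
  let ?P = "poly_alg (Delta Xs) :: ('k, (nat \<times> 'x, 'k) mpoly) module"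
  let ?J = "DI ?P (der lam) (i_hat ` S_A)"
  have S: "S_A \<subseteq> carrier (poly_alg Xs)"
    using assms(3) by (simp add: gs_basis_def)
  show "diff_gs_basis lam Xs (i_hat ` S_A)"
    using assms(1,3) by (rule diff_gs_basis_i_hat)
  show "free_comm_diff_algebra TYPE('r) lam (alg_quot (poly_alg Xs) I_A) (alg_quot ?P ?J)
      (coset_map ?P ?J (der lam)) (coset_map ?P ?J i_hat)"
    unfolding assms(4) using S by (rule free_comm_diff_algebra_quot)
  fix CD :: "('k, 'c) module" and d_CD i_CD
  assume CD: "free_comm_diff_algebra TYPE('c) lam (alg_quot (poly_alg Xs) I_A) CD d_CD i_CD \<and>
    free_comm_diff_algebra TYPE((nat \<times> 'x, 'k) mpoly set) lam (alg_quot (poly_alg Xs) I_A) CD d_CD i_CD"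
  show "diff_alg_isomorphic CD d_CD (alg_quot ?P ?J) (coset_map ?P ?J (der lam))"
    \<comment> \<open>\<open>free_comm_diff_algebra_quot\<close> is polymorphic in the test type, so
      it supplies both instances needed for the quotient.\<close>
    using CD[THEN conjunct1] CD[THEN conjunct2] unfolding assms(4)
    by (rule free_comm_diff_algebra_unique[OF _ _ free_comm_diff_algebra_quot[OF S] free_comm_diff_algebra_quot[OF S]])
qed

end
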